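(* Let $n\in\mathbb{N}$, $s\in\{0,1,\ldots,n-1\}$, let $P,Q$ be finite index sets, and let $f\in C^2(\mathbb{R}^n,\mathbb{R})$, $h=(h_p,p\in P)\in C^2(\mathbb{R}^n,\mathbb{R}^{|P|})$, $g=(g_q,q\in Q)\in C^2(\mathbb{R}^n,\mathbb{R}^{|Q|})$. Let $c\in\mathbb{R}^n$ have positive and pairwise different components, and let $0<\varepsilon\le\frac{1}{n-s}$. If $\bar x$ is an M-stationary point of CCOP, then there exist at least $\binom{n-\|\bar x\|_0-1}{n-s-1}$ choices of $\bar y\in\mathbb{R}^n$ such that $(\bar x,\bar y)$ is a T-stationary point of $\mathcal{R}(c,\varepsilon)$. If $\bar x$ is additionally nondegenerate with M-index $m$, then all corresponding T-stationary points $(\bar x,\bar y)$ of $\mathcal{R}(c,\varepsilon)$ (i.e. all T-stationary points of $\mathcal{R}(c,\varepsilon)$ with $x$-part $\bar x$) are also nondegenerate with T-index $m$; moreover, their number is exactly $\binom{n-\|\bar x\|_0-1}{n-s-1}$, and condition NDT5 holds at each of them.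
   Context: CCOP is the problem $\min_x f(x)$ s.t. $h(x)=0$, $g(x)\ge 0$, $\|x\|_0\le s$, where $\|x\|_0=|\{i\in\{1,\ldots,n\}: x_i\neq 0\}|$. The regularized continuous reformulation is $$\mathcal{R}(c,\varepsilon):\ \min_{x,y\in\mathbb{R}^n} f(x)+c^Ty\ \text{ s.t. } h(x)=0,\ g(x)\ge 0,\ \sum_{i=1}^n y_i\ge n-s,\ x_iy_i=0,\ 0\le y_i\le 1+\varepsilon,\ i=1,\ldots,n.$$ Notation: $e_i$ is the $i$-th coordinate vector of $\mathbb{R}^n$ and $e=(1,\ldots,1)^T\in\mathbb{R}^n$. Put $Q_0(\bar x)=\{q\in Q: g_q(\bar x)=0\}$ and $I_0(\bar x)=\{i:\bar x_i=0\}$. For $(\bar x,\bar y)$ feasible for $\mathcal{R}(c,\varepsilon)$ put $a_{00}=\{i:\bar x_i=0,\bar y_i=0\}$, $a_{01}=\{i:\bar x_i=0,\bar y_i>0\}$, $a_{10}=\{i:\bar x_i\ne0,\bar y_i=0\}$, $\mathcal{E}(\bar y)=\{i:\bar y_i=1+\varepsilon\}$. For a symmetric matrix $A$ and a linear subspace $T$, $A\restriction_T$ denotes $V^TAV$, where the columns of $V$ form a basis of $T$ (nonsingularity and the number of negative eigenvalues do not depend on the basis). **CCOP notions.** A CCOP feasible point $\bar x$ is M-stationary if there exist multipliers $\bar\lambda_p$ ($p\in P$), $\bar\mu_q$ ($q\in Q_0(\bar x)$), $\bar\gamma_i$ ($i\in I_0(\bar x)$) with $\nabla f(\bar x)=\sum_{p\in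 P}\bar\lambda_p\nabla h_p(\bar x)+\sum_{q\in Q_0(\bar x)}\bar\mu_q\nabla g_q(\bar x)+\sum_{i\in I_0(\bar x)}\bar\gamma_ie_i$ and $\bar\mu_q\ge0$ for all $q\in Q_0(\bar x)$. CC-LICQ at $\bar x$ means that $\nabla h_p(\bar x)$, $p\in P$; $\nabla g_q(\bar x)$, $q\in Q_0(\bar x)$; $e_i$, $i\in I_0(\bar x)$, are linearly independent. Let $L(x)=f(x)-\sum_{p\in P}\bar\lambda_ph_p(x)-\sum_{q\in Q_0(\bar x)}\bar\mu_qg_q(x)-\sum_{i\in I_0(\bar x)}\bar\gamma_ix_i$ and $\mathcal{T}_{\bar x}=\{\xi\in\mathbb{R}^n: Dh_p(\bar x)\xi=0\ (p\in P),\ Dg_q(\bar x)\xi=0\ (q\in Q_0(\bar x)),\ \xi_i=0\ (i\in I_0(\bar x))\}$. An M-stationary point $\bar x$ is nondegenerate if: (NDM1) CC-LICQ holds at $\bar x$; (NDM2) $\bar\mu_q>0$ for all $q\in Q_0(\bar x)$; (NDM3) if $\|\bar x\|_0<s$ then $\bar\gamma_i\ne0$ for all $i\in I_0(\bar x)$; (NDM4) $D^2L(\bar x)\restriction_{\mathcal{T}_{\bar x}}$ is nonsingular. The M-index of a nondegenerate M-stationary point $\bar x$ is $QI+SI$, where $QI$ is the number of negative eigenvalues of $D^2L(\bar x)\restriction_{\mathcal{T}_{\bar x}}$ and $SI=s-\|\bar x\|_0$. **$\mathcal{R}$ notions.** A feasible point $(\bar x,\bar y)$ of $\mathcal{R}(c,\varepsilon)$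 is T-stationary if there exist real multipliers $\bar\lambda_p$ ($p\in P$), $\bar\mu_{1,q}$ ($q\in Q_0(\bar x)$), $\bar\mu_{2,i}$ ($i\in\mathcal{E}(\bar y)$), $\bar\mu_3$, $\bar\sigma_{1,i}$ ($i\in a_{01}$), $\bar\sigma_{2,i}$ ($i\in a_{10}$), $\bar\varrho_{1,i},\bar\varrho_{2,i}$ ($i\in a_{00}$) such that $$\begin{pmatrix}\nabla f(\bar x)\\ c\end{pmatrix}=\sum_{p\in P}\bar\lambda_p\begin{pmatrix}\nabla h_p(\bar x)\\ 0\end{pmatrix}+\sum_{q\in Q_0(\bar x)}\bar\mu_{1,q}\begin{pmatrix}\nabla g_q(\bar x)\\ 0\end{pmatrix}-\sum_{i\in\mathcal{E}(\bar y)}\bar\mu_{2,i}\begin{pmatrix}0\\ e_i\end{pmatrix}+\bar\mu_3\begin{pmatrix}0\\ e\end{pmatrix}+\sum_{i\in a_{01}}\bar\sigma_{1,i}\begin{pmatrix}e_i\\ 0\end{pmatrix}+\sum_{i\in a_{10}}\bar\sigma_{2,i}\begin{pmatrix}0\\ e_i\end{pmatrix}+\sum_{i\in a_{00}}\left(\bar\varrho_{1,i}\begin{pmatrix}e_i\\ 0\end{pmatrix}+\bar\varrho_{2,i}\begin{pmatrix}0\\ e_i\end{pmatrix}\right),$$ $\bar\mu_{1,q}\ge0$ ($q\in Q_0(\bar x)$), $\bar\mu_{2,i}\ge0$ ($i\in\mathcal{E}(\bar y)$), $\bar\mu_3\ge0$, $\bar\mu_3\left(\sum_{i=1}^n\bar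 y_i-(n-s)\right)=0$, and, for all $i\in a_{00}$, $\bar\varrho_{1,i}=0$ or $\bar\varrho_{2,i}\le0$. MPOC-LICQ at $(\bar x,\bar y)$ means that the following vectors of $\mathbb{R}^{2n}$ (as a family) are linearly independent: $(\nabla h_p(\bar x),0)$, $p\in P$; $(\nabla g_q(\bar x),0)$, $q\in Q_0(\bar x)$; $(0,e_i)$, $i\in\mathcal{E}(\bar y)$; $(0,e)$ if $\sum_i\bar y_i=n-s$; $(e_i,0)$, $i\in a_{01}\cup a_{00}$; $(0,e_i)$, $i\in a_{10}\cup a_{00}$. Let $$L^{\mathcal{R}}(x,y)=f(x)+c^Ty-\sum_{p}\bar\lambda_ph_p(x)-\sum_{q\in Q_0(\bar x)}\bar\mu_{1,q}g_q(x)+\sum_{i\in\mathcal{E}(\bar y)}\bar\mu_{2,i}(y_i-(1+\varepsilon))-\bar\mu_3\Big(\sum_{i=1}^ny_i-(n-s)\Big)-\sum_{i\in a_{01}}\bar\sigma_{1,i}x_i-\sum_{i\in a_{10}}\bar\sigma_{2,i}y_i-\sum_{i\in a_{00}}(\bar\varrho_{1,i}x_i+\bar\varrho_{2,i}y_i)$$ and let $\mathcal{T}^{\mathcal{R}}_{(\bar x,\bar y)}$ be the set of $\xi\in\mathbb{R}^{2n}$ with $(Dh_p(\bar x),0)\xi=0$ ($p\in P$), $(Dg_q(\bar x),0)\xi=0$ ($q\in Q_0(\bar x)$), $(0,e_i)\xi=0$ ($i\in\mathcal{E}(\bar y)$), $(0,e)\xi=0$ if $\sum_i\bar y_i=n-s$,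 $(e_i,0)\xi=0$ ($i\in a_{00}\cup a_{01}$), $(0,e_i)\xi=0$ ($i\in a_{00}\cup a_{10}$). A T-stationary point $(\bar x,\bar y)$ is nondegenerate if: (NDT1) MPOC-LICQ holds at $(\bar x,\bar y)$; (NDT2) $\bar\mu_{1,q}>0$ for all $q\in Q_0(\bar x)$, $\bar\mu_{2,i}>0$ for all $i\in\mathcal{E}(\bar y)$, and $\bar\mu_3>0$ if $\sum_i\bar y_i=n-s$; (NDT3) $\bar\varrho_{1,i}\ne0$ and $\bar\varrho_{2,i}<0$ for all $i\in a_{00}$; (NDT4) $D^2L^{\mathcal{R}}(\bar x,\bar y)\restriction_{\mathcal{T}^{\mathcal{R}}_{(\bar x,\bar y)}}$ is nonsingular. A nondegenerate T-stationary point satisfies NDT5 if: whenever $a_{00}\ne\emptyset$, then $\bar\sigma_{1,i}\ne0$ for all $i\in a_{01}$. The T-index of a nondegenerate T-stationary point is $QI+BI$, where $QI$ is the number of negative eigenvalues of $D^2L^{\mathcal{R}}(\bar x,\bar y)\restriction_{\mathcal{T}^{\mathcal{R}}_{(\bar x,\bar y)}}$ and $BI=|a_{00}|$. (Multipliers are unique under CC-LICQ, respectively MPOC-LICQ.) *)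

theory Defs
  imports "Jordan_Normal_Form.Char_Poly" "HOL-Analysis.Analysis"
begin

(* Both libraries use these two infix symbols; here they refer to HOL-Analysis only. *)
no_notation Matrix.vec_index (infixl \<open>$\<close> 100)
no_notation Matrix.scalar_prod (infix \<open>\<bullet>\<close> 70)

section \<open>Gradients, Hessians and functions of class $C^2$\<close>

definition gradient :: "('a::euclidean_space \<Rightarrow> real) \<Rightarrow> 'a \<Rightarrow> 'a" where
  "gradient \<phi> x = (THE d. GDERIV \<phi> x :> d)"

lemma gradient_eqI:
  assumes "GDERIV \<phi> x :> d"
  shows "gradient \<phi> x = d"
proof -
  have "d' = d" if "GDERIV \<phi> x :> d'" for d'
  proof -
    have "(\<lambda>h. h \<bullet> d') = (\<lambda>h. h \<bullet> d)"
      using has_derivative_unique that assms unfolding gderiv_def by blast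
    then show ?thesis
      by (metis inner_commute vector_eq_ldot)
  qed
  with assms show ?thesis
    unfolding gradient_def by blast
qed

definition hessian :: "('a::euclidean_space \<Rightarrow> real) \<Rightarrow> 'a \<Rightarrow> 'a \<Rightarrow> 'a" where
  "hessian \<phi> x = frechet_derivative (gradient \<phi>) (at x)"

definition C2 :: "('a::euclidean_space \<Rightarrow> real) \<Rightarrow> bool" where
  "C2 \<phi> \<longleftrightarrow> (\<exists>(\<phi>' :: 'a \<Rightarrow> 'a) (\<phi>'' :: 'a \<Rightarrow> 'a \<Rightarrow>\<^sub>L 'a).
     (\<forall>x. GDERIV \<phi> x :> \<phi>' x) \<and>
     (\<forall>x. (\<phi>' has_derivative blinfun_apply (\<phi>'' x)) (at x)) \<and>
     continuous_on UNIV \<phi>'')"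

section \<open>Restriction of a symmetric matrix to a subspace\<close>

definition is_basis :: "'a::real_vector list \<Rightarrow> 'a set \<Rightarrow> bool" where
  "is_basis vs T \<longleftrightarrow> distinct vs \<and> independent (set vs) \<and> span (set vs) = T"

(* The matrix V^T A V, where V has the columns vs and the matrix A is given as a linear map. *)
definition restricted_mat :: "('a::euclidean_space \<Rightarrow> 'a) \<Rightarrow> 'a list \<Rightarrow> real mat" where
  "restricted_mat A vs =
     Matrix.mat (length vs) (length vs) (\<lambda>(i, j). (vs ! i) \<bullet> A (vs ! j))"

(* Nonsingularity does not depend on the basis of T, so one basis is enough. *)
definition nonsingular_on :: "('a::euclidean_space \<Rightarrow> 'a) \<Rightarrow> 'a set \<Rightarrow> bool" where
  "nonsingular_on A T \<longleftrightarrow> (\<exists>vs. is_basis vs T \<and> invertible_mat (restricted_mat A vs))"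

(* Eigenvalues are counted with multiplicity. *)
definition neg_eigenvalue_count :: "real mat \<Rightarrow> nat" where
  "neg_eigenvalue_count M = (\<Sum>r | eigenvalue M r \<and> r < 0. order r (char_poly M))"

(* For symmetric A the count is the same for all bases of the subspace T
   (Sylvester's law of inertia). *)
definition neg_eigenvalues_on :: "('a::euclidean_space \<Rightarrow> 'a) \<Rightarrow> 'a set \<Rightarrow> nat" where
  "neg_eigenvalues_on A T =
     (THE k. \<exists>vs. is_basis vs T \<and> k = neg_eigenvalue_count (restricted_mat A vs))"

section \<open>Linear independence of indexed families\<close>

definition independent_family :: "'i set \<Rightarrow> ('i \<Rightarrow> 'a::real_vector) \<Rightarrow> bool" where
  "independent_family I v \<longleftrightarrow> inj_on v I \<and> independent (v ` I)"

section \<open>The cardinality-constrained problem and its regularized reformulation\<close>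

definition l0_norm :: "real ^ 'n \<Rightarrow> nat" where
  "l0_norm x = card {i. x $ i \<noteq> 0}"

context
  fixes f :: "real ^ 'n \<Rightarrow> real"
    and P :: "'p set" and h :: "'p \<Rightarrow> real ^ 'n \<Rightarrow> real"
    and Q :: "'q set" and g :: "'q \<Rightarrow> real ^ 'n \<Rightarrow> real"
    and s :: nat
    and c :: "real ^ 'n" and \<epsilon> :: real
begin

definition Q0 :: "real ^ 'n \<Rightarrow> 'q set" where
  "Q0 x = {q \<in> Q. g q x = 0}"

definition I0 :: "real ^ 'n \<Rightarrow> 'n set" where
  "I0 x = {i. x $ i = 0}"

subsection \<open>M-stationarity\<close>

definition CCOP_feasible :: "real ^ 'n \<Rightarrow> bool" where
  "CCOP_feasible x \<longleftrightarrow>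
     (\<forall>p\<in>P. h p x = 0) \<and> (\<forall>q\<in>Q. g q x \<ge> 0) \<and> l0_norm x \<le> s"

(* Multipliers are total functions; only their values on P, Q0 x and I0 x matter. *)
definition M_multipliers ::
    "real ^ 'n \<Rightarrow> ('p \<Rightarrow> real) \<Rightarrow> ('q \<Rightarrow> real) \<Rightarrow> ('n \<Rightarrow> real) \<Rightarrow> bool" where
  "M_multipliers x lam \<mu> \<gamma> \<longleftrightarrow>
     gradient f x = (\<Sum>p\<in>P. lam p *\<^sub>R gradient (h p) x)
       + (\<Sum>q\<in>Q0 x. \<mu> q *\<^sub>R gradient (g q) x)
       + (\<Sum>i\<in>I0 x. \<gamma> i *\<^sub>R axis i 1) \<and>
     (\<forall>q\<in>Q0 x. \<mu> q \<ge> 0)"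

definition M_stationary :: "real ^ 'n \<Rightarrow> bool" where
  "M_stationary x \<longleftrightarrow> CCOP_feasible x \<and> (\<exists>lam \<mu> \<gamma>. M_multipliers x lam \<mu> \<gamma>)"

definition CC_LICQ :: "real ^ 'n \<Rightarrow> bool" where
  "CC_LICQ x \<longleftrightarrow>
     independent_family (P <+> Q0 x <+> I0 x)
       (case_sum (\<lambda>p. gradient (h p) x)
       (case_sum (\<lambda>q. gradient (g q) x)
                 (\<lambda>i. axis i 1)))"

definition M_Lagrangian ::
    "real ^ 'n \<Rightarrow> ('p \<Rightarrow> real) \<Rightarrow> ('q \<Rightarrow> real) \<Rightarrow> ('n \<Rightarrow> real) \<Rightarrow> real ^ 'n \<Rightarrow> real" where
  "M_Lagrangian xb lam \<mu> \<gamma> x =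
     f x - (\<Sum>p\<in>P. lam p * h p x) - (\<Sum>q\<in>Q0 xb. \<mu> q * g q x) - (\<Sum>i\<in>I0 xb. \<gamma> i * x $ i)"

definition M_tangent :: "real ^ 'n \<Rightarrow> (real ^ 'n) set" where
  "M_tangent x = {\<xi>. (\<forall>p\<in>P. gradient (h p) x \<bullet> \<xi> = 0) \<and>
     (\<forall>q\<in>Q0 x. gradient (g q) x \<bullet> \<xi> = 0) \<and> (\<forall>i\<in>I0 x. \<xi> $ i = 0)}"

definition M_nondegenerate :: "real ^ 'n \<Rightarrow> bool" where
  "M_nondegenerate x \<longleftrightarrow> CCOP_feasible x \<and>
     (\<exists>lam \<mu> \<gamma>. M_multipliers x lam \<mu> \<gamma> \<and>
        CC_LICQ x \<and>
        (\<forall>q\<in>Q0 x. \<mu> q > 0) \<and>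
        (l0_norm x < s \<longrightarrow> (\<forall>i\<in>I0 x. \<gamma> i \<noteq> 0)) \<and>
        nonsingular_on (hessian (M_Lagrangian x lam \<mu> \<gamma>) x) (M_tangent x))"

(* Meaningful at nondegenerate points, where CC-LICQ makes the multipliers unique. *)
definition M_index :: "real ^ 'n \<Rightarrow> nat" where
  "M_index x = (THE m. \<exists>lam \<mu> \<gamma>. M_multipliers x lam \<mu> \<gamma> \<and>
     m = neg_eigenvalues_on (hessian (M_Lagrangian x lam \<mu> \<gamma>) x) (M_tangent x)
         + (s - l0_norm x))"

subsection \<open>T-stationarity\<close>

definition R_feasible :: "real ^ 'n \<Rightarrow> real ^ 'n \<Rightarrow> bool" where
  "R_feasible x y \<longleftrightarrow>
     (\<forall>p\<in>P. h p x = 0) \<and> (\<forall>q\<in>Q. g q x \<ge> 0) \<and>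
     (\<Sum>i\<in>UNIV. y $ i) \<ge> real CARD('n) - real s \<and>
     (\<forall>i. x $ i * y $ i = 0 \<and> 0 \<le> y $ i \<and> y $ i \<le> 1 + \<epsilon>)"

definition a00 :: "real ^ 'n \<Rightarrow> real ^ 'n \<Rightarrow> 'n set" where
  "a00 x y = {i. x $ i = 0 \<and> y $ i = 0}"

definition a01 :: "real ^ 'n \<Rightarrow> real ^ 'n \<Rightarrow> 'n set" where
  "a01 x y = {i. x $ i = 0 \<and> y $ i > 0}"

definition a10 :: "real ^ 'n \<Rightarrow> real ^ 'n \<Rightarrow> 'n set" where
  "a10 x y = {i. x $ i \<noteq> 0 \<and> y $ i = 0}"

definition E_active :: "real ^ 'n \<Rightarrow> 'n set" where
  "E_active y = {i. y $ i = 1 + \<epsilon>}"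

definition sum_active :: "real ^ 'n \<Rightarrow> bool" where
  "sum_active y \<longleftrightarrow> (\<Sum>i\<in>UNIV. y $ i) = real CARD('n) - real s"

definition T_multipliers ::
    "real ^ 'n \<Rightarrow> real ^ 'n \<Rightarrow> ('p \<Rightarrow> real) \<Rightarrow> ('q \<Rightarrow> real) \<Rightarrow> ('n \<Rightarrow> real) \<Rightarrow> real \<Rightarrow>
     ('n \<Rightarrow> real) \<Rightarrow> ('n \<Rightarrow> real) \<Rightarrow> ('n \<Rightarrow> real) \<Rightarrow> ('n \<Rightarrow> real) \<Rightarrow> bool" where
  "T_multipliers x y lam \<mu>1 \<mu>2 \<mu>3 \<sigma>1 \<sigma>2 \<rho>1 \<rho>2 \<longleftrightarrow>
     (gradient f x, c) =
         (\<Sum>p\<in>P. lam p *\<^sub>R (gradient (h p) x, 0))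
       + (\<Sum>q\<in>Q0 x. \<mu>1 q *\<^sub>R (gradient (g q) x, 0))
       - (\<Sum>i\<in>E_active y. \<mu>2 i *\<^sub>R (0, axis i 1))
       + \<mu>3 *\<^sub>R (0, \<chi> i. 1)
       + (\<Sum>i\<in>a01 x y. \<sigma>1 i *\<^sub>R (axis i 1, 0))
       + (\<Sum>i\<in>a10 x y. \<sigma>2 i *\<^sub>R (0, axis i 1))
       + (\<Sum>i\<in>a00 x y. \<rho>1 i *\<^sub>R (axis i 1, 0) + \<rho>2 i *\<^sub>R (0, axis i 1)) \<and>
     (\<forall>q\<in>Q0 x. \<mu>1 q \<ge> 0) \<and> (\<forall>i\<in>E_active y. \<mu>2 i \<ge> 0) \<and> \<mu>3 \<ge> 0 \<and>
     \<mu>3 * ((\<Sum>i\<in>UNIV. y $ i) - (real CARD('n) - real s)) = 0 \<and>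
     (\<forall>i\<in>a00 x y. \<rho>1 i = 0 \<or> \<rho>2 i \<le> 0)"

definition T_stationary :: "real ^ 'n \<Rightarrow> real ^ 'n \<Rightarrow> bool" where
  "T_stationary x y \<longleftrightarrow> R_feasible x y \<and>
     (\<exists>lam \<mu>1 \<mu>2 \<mu>3 \<sigma>1 \<sigma>2 \<rho>1 \<rho>2. T_multipliers x y lam \<mu>1 \<mu>2 \<mu>3 \<sigma>1 \<sigma>2 \<rho>1 \<rho>2)"

definition MPOC_LICQ :: "real ^ 'n \<Rightarrow> real ^ 'n \<Rightarrow> bool" where
  "MPOC_LICQ x y \<longleftrightarrow>
     independent_family
       (P <+> Q0 x <+> E_active y <+> (if sum_active y then {()} else {})
          <+> (a01 x y \<union> a00 x y) <+> (a10 x y \<union> a00 x y))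
       (case_sum (\<lambda>p. (gradient (h p) x, 0))
       (case_sum (\<lambda>q. (gradient (g q) x, 0))
       (case_sum (\<lambda>i. (0, axis i 1))
       (case_sum (\<lambda>_. (0, \<chi> i. 1))
       (case_sum (\<lambda>i. (axis i 1, 0))
                 (\<lambda>i. (0, axis i 1))))))
        :: _ \<Rightarrow> (real ^ 'n) \<times> (real ^ 'n))"

definition T_Lagrangian ::
    "real ^ 'n \<Rightarrow> real ^ 'n \<Rightarrow> ('p \<Rightarrow> real) \<Rightarrow> ('q \<Rightarrow> real) \<Rightarrow> ('n \<Rightarrow> real) \<Rightarrow> real \<Rightarrow>
     ('n \<Rightarrow> real) \<Rightarrow> ('n \<Rightarrow> real) \<Rightarrow> ('n \<Rightarrow> real) \<Rightarrow> ('n \<Rightarrow> real) \<Rightarrow>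
     (real ^ 'n) \<times> (real ^ 'n) \<Rightarrow> real" where
  "T_Lagrangian xb yb lam \<mu>1 \<mu>2 \<mu>3 \<sigma>1 \<sigma>2 \<rho>1 \<rho>2 = (\<lambda>(x, y).
     f x + c \<bullet> y - (\<Sum>p\<in>P. lam p * h p x) - (\<Sum>q\<in>Q0 xb. \<mu>1 q * g q x)
       + (\<Sum>i\<in>E_active yb. \<mu>2 i * (y $ i - (1 + \<epsilon>)))
       - \<mu>3 * ((\<Sum>i\<in>UNIV. y $ i) - (real CARD('n) - real s))
       - (\<Sum>i\<in>a01 xb yb. \<sigma>1 i * x $ i)
       - (\<Sum>i\<in>a10 xb yb. \<sigma>2 i * y $ i)
       - (\<Sum>i\<in>a00 xb yb. \<rho>1 i * x $ i + \<rho>2 i * y $ i))"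

definition T_tangent :: "real ^ 'n \<Rightarrow> real ^ 'n \<Rightarrow> ((real ^ 'n) \<times> (real ^ 'n)) set" where
  "T_tangent x y = {\<xi>.
     (\<forall>p\<in>P. (gradient (h p) x, 0) \<bullet> \<xi> = 0) \<and>
     (\<forall>q\<in>Q0 x. (gradient (g q) x, 0) \<bullet> \<xi> = 0) \<and>
     (\<forall>i\<in>E_active y. (0, axis i 1) \<bullet> \<xi> = 0) \<and>
     (sum_active y \<longrightarrow> (0, \<chi> i. 1) \<bullet> \<xi> = 0) \<and>
     (\<forall>i\<in>a00 x y \<union> a01 x y. (axis i 1, 0) \<bullet> \<xi> = 0) \<and>
     (\<forall>i\<in>a00 x y \<union> a10 x y. (0, axis i 1) \<bullet> \<xi> = 0)}"

definition T_nondegenerate :: "real ^ 'n \<Rightarrow> real ^ 'n \<Rightarrow> bool" where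
  "T_nondegenerate x y \<longleftrightarrow> R_feasible x y \<and>
     (\<exists>lam \<mu>1 \<mu>2 \<mu>3 \<sigma>1 \<sigma>2 \<rho>1 \<rho>2. T_multipliers x y lam \<mu>1 \<mu>2 \<mu>3 \<sigma>1 \<sigma>2 \<rho>1 \<rho>2 \<and>
        MPOC_LICQ x y \<and>
        (\<forall>q\<in>Q0 x. \<mu>1 q > 0) \<and> (\<forall>i\<in>E_active y. \<mu>2 i > 0) \<and> (sum_active y \<longrightarrow> \<mu>3 > 0) \<and>
        (\<forall>i\<in>a00 x y. \<rho>1 i \<noteq> 0 \<and> \<rho>2 i < 0) \<and>
        nonsingular_on (hessian (T_Lagrangian x y lam \<mu>1 \<mu>2 \<mu>3 \<sigma>1 \<sigma>2 \<rho>1 \<rho>2) (x, y))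
          (T_tangent x y))"

(* NDT5 and T_index are meaningful at nondegenerate points, where MPOC-LICQ makes the
   multipliers unique. *)
definition NDT5 :: "real ^ 'n \<Rightarrow> real ^ 'n \<Rightarrow> bool" where
  "NDT5 x y \<longleftrightarrow>
     (\<exists>lam \<mu>1 \<mu>2 \<mu>3 \<sigma>1 \<sigma>2 \<rho>1 \<rho>2. T_multipliers x y lam \<mu>1 \<mu>2 \<mu>3 \<sigma>1 \<sigma>2 \<rho>1 \<rho>2 \<and>
        (a00 x y \<noteq> {} \<longrightarrow> (\<forall>i\<in>a01 x y. \<sigma>1 i \<noteq> 0)))"

definition T_index :: "real ^ 'n \<Rightarrow> real ^ 'n \<Rightarrow> nat" where
  "T_index x y = (THE m.
     \<exists>lam \<mu>1 \<mu>2 \<mu>3 \<sigma>1 \<sigma>2 \<rho>1 \<rho>2. T_multipliers x y lam \<mu>1 \<mu>2 \<mu>3 \<sigma>1 \<sigma>2 \<rho>1 \<rho>2 \<and>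
        m = neg_eigenvalues_on
              (hessian (T_Lagrangian x y lam \<mu>1 \<mu>2 \<mu>3 \<sigma>1 \<sigma>2 \<rho>1 \<rho>2) (x, y)) (T_tangent x y)
            + card (a00 x y))"

end

end

theory Submission
  imports Defs
begin

text \<open>The $y$-part of the T-stationarity condition forces $c_i = \mu_3$ for every $i$ with
  $0 < y_i < 1+\varepsilon$ and $\mu_3 > 0$, so there is at most one such index and the
  constraint $\sum_i y_i \ge n-s$ is active. As $\varepsilon \le 1/(n-s)$, counting leaves
  exactly one such index $j$, with $y_j = 1-(n-s-1)\varepsilon$, and exactly $n-s-1$ indices
  with $y_i = 1+\varepsilon$. Taking for $j$ the maximizer of $c$ over $I_0(x)$ and for the
  others an arbitrary subset of $I_0(x) \setminus \{j\}$ gives the binomial coefficient;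
  nondegeneracy excludes every other $j$. The Lagrangian is affine in $y$ and
  the tangent space is that of CCOP times $\{0\}$, so bases correspond one to one and yield
  literally the same restricted Hessian matrices. The index sets $a_{00}$ have $s - \|x\|_0$
  elements.\<close>

section \<open>Linear independence and bases under injective linear maps\<close>

text \<open>Coefficients indexed by \<open>I\<close> rather than by the vectors absorb the
  injectivity condition: a repeated vector gives the nontrivial relation with coefficients 1 and -1.
  Both LICQ conditions are used in this form.\<close>

lemma independent_family_iff:
  assumes "finite I"
  shows "independent_family I v \<longleftrightarrow> (\<forall>u. (\<Sum>i\<in>I. u i *\<^sub>R v i) = 0 \<longrightarrow> (\<forall>i\<in>I. u i = 0))"
proof
  assume ind: "independent_family I v"
  show "\<forall>u. (\<Sum>i\<in>I. u i *\<^sub>R v i) = 0 \<longrightarrow> (\<forall>i\<in>I. u i = 0)"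
  proof (intro allI impI ballI)
    fix u i assume u: "(\<Sum>i\<in>I. u i *\<^sub>R v i) = 0" and i: "i \<in> I"
    from ind have inj: "inj_on v I" and li: "independent (v ` I)"
      by (auto simp: independent_family_def)
    have "(\<Sum>w\<in>v ` I. u (inv_into I v w) *\<^sub>R w) = 0"
      using u inj by (simp add: sum.reindex)
    then have "u (inv_into I v (v i)) = 0"
      using independentD[OF li, of "v ` I" "\<lambda>w. u (inv_into I v w)"] assms i by blast
    then show "u i = 0" using inj i by simp
  qed
next
  assume u: "\<forall>u. (\<Sum>i\<in>I. u i *\<^sub>R v i) = 0 \<longrightarrow> (\<forall>i\<in>I. u i = 0)"
  have inj: "inj_on v I"
  proof (rule inj_onI, rule ccontr)
    fix a b assume ab: "a \<in> I" "b \<in> I" "v a = v b" "a \<noteq> b"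
    define w where "w i = (if i = a then 1 else 0) - (if i = b then 1 else 0 :: real)" for i
    have "(\<Sum>i\<in>I. w i *\<^sub>R v i) = (\<Sum>i\<in>I. (if i = a then v i else 0) - (if i = b then v i else 0))"
      by (intro sum.cong) (auto simp: w_def)
    also have "\<dots> = 0" using assms ab by (simp add: sum_subtractf)
    finally have "w a = 0" using u ab by blast
    then show False using ab by (simp add: w_def)
  qed
  moreover have "independent (v ` I)"

  proof -
    show ?thesis
    proof (rule independent_if_scalars_zero)
      show "finite (v ` I)" using assms by simp
      fix w x assume "(\<Sum>x\<in>v ` I. w x *\<^sub>R x) = 0" and x: "x \<in> v ` I"
      then have "(\<Sum>i\<in>I. w (v i) *\<^sub>R v i) = 0" using inj by (simp add: sum.reindex)
      then show "w x = 0" using u[rule_format, of "\<lambda>i. w (v i)"] x by blast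
    qed
  qed
  ultimately show "independent_family I v" by (simp add: independent_family_def)
qed

text \<open>A basis of the image lies in the range of \<open>j\<close> and so can be pulled back
  entry by entry; an injective linear map preserves and reflects independence and commutes with
  spans. It is applied to the embedding of \<open>v\<close> as \<open>(v, 0)\<close>.\<close>

lemma is_basis_linear_image:
  assumes j: "linear j" "inj j"
  shows "is_basis vs (j ` T) \<longleftrightarrow> (\<exists>ws. vs = map j ws \<and> is_basis ws T)"
proof -
  have map: "is_basis (map j ws) (j ` T) \<longleftrightarrow> is_basis ws T" for ws
  proof -
    have "independent (j ` set ws) \<longleftrightarrow> independent (set ws)"
    proof
      assume i: "independent (j ` set ws)"
      show "independent (set ws)"
        unfolding dependent_def
      proof
        assume "\<exists>a\<in>set ws. a \<in> span (set ws - {a})"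
        then obtain a where a: "a \<in> set ws" "j a \<in> j ` span (set ws - {a})" by blast
        then have "j a \<in> span (j ` set ws - {j a})"
          using linear_span_image[OF j(1), of "set ws - {a}"] image_set_diff[OF j(2), of "set ws" "{a}"]
          by simp
        with i a(1) show False unfolding dependent_def by blast
      qed
    qed (use linear_independent_injective_image[OF j(1)] j(2) in \<open>blast intro: inj_on_subset\<close>)
    then show ?thesis
      using j by (auto simp: is_basis_def distinct_map linear_span_image inj_image_eq_iff
        intro: inj_on_subset)
  qed
  show ?thesis
  proof
    assume b: "is_basis vs (j ` T)"
    then have "set vs \<subseteq> range j"
      unfolding is_basis_def using span_superset by blast
    then obtain ws where "vs = map j ws" by (metis ex_map_conv imageE subsetD)
    with b map show "\<exists>ws. vs = map j ws \<and> is_basis ws T" by blast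
  qed (use map in blast)
qed

text \<open>The entries are values of the bilinear forms on the basis vectors, so the two matrices
  are equal, not merely congruent or similar.\<close>

lemma restricted_mat_map:
  assumes "\<And>u v. j u \<bullet> B (j v) = u \<bullet> A v"
  shows "restricted_mat B (map j ws) = restricted_mat A ws"
  unfolding restricted_mat_def by (rule Matrix.eq_matI) (simp_all add: assms)

lemma nonsingular_on_linear_image:
  assumes "linear j" "inj j" "\<And>u v. j u \<bullet> B (j v) = u \<bullet> A v"
  shows "nonsingular_on B (j ` T) \<longleftrightarrow> nonsingular_on A T"
  unfolding nonsingular_on_def is_basis_linear_image[OF assms(1,2)]
  using restricted_mat_map[of j B A, OF assms(3)] by metis

text \<open>Bases correspond and yield equal matrices, so the same numbers \<open>k\<close> satisfy
  the two definite descriptions, and the \<open>THE\<close> terms agree.\<close>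

lemma neg_eigenvalues_on_linear_image:
  assumes "linear j" "inj j" "\<And>u v. j u \<bullet> B (j v) = u \<bullet> A v"
  shows "neg_eigenvalues_on B (j ` T) = neg_eigenvalues_on A T"
proof -
  have "(\<exists>vs. is_basis vs (j ` T) \<and> k = neg_eigenvalue_count (restricted_mat B vs)) \<longleftrightarrow>
        (\<exists>vs. is_basis vs T \<and> k = neg_eigenvalue_count (restricted_mat A vs))" for k
    unfolding is_basis_linear_image[OF assms(1,2)]
    using restricted_mat_map[of j B A, OF assms(3)] by metis
  then show ?thesis by (simp add: neg_eigenvalues_on_def)
qed

section \<open>Gradients and Hessians of twice continuously differentiable functions\<close>

lemma C2_gderiv:
  assumes "C2 \<phi>"
  shows "GDERIV \<phi> x :> gradient \<phi> x"
  using assms gradient_eqI unfolding C2_def by metis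

lemma C2_gradient_differentiable:
  assumes "C2 \<phi>"
  shows "gradient \<phi> differentiable (at x)"
proof -
  obtain \<phi>' \<phi>'' where d: "\<And>x. GDERIV \<phi> x :> \<phi>' x"
    "\<And>x. (\<phi>' has_derivative blinfun_apply (\<phi>'' x)) (at x)"
    using assms unfolding C2_def by blast
  then have "gradient \<phi> = \<phi>'" using gradient_eqI by blast
  with d(2) show ?thesis by (auto simp: differentiable_def)
qed

text \<open>A summand affine in \<open>y\<close> adds only the constant \<open>w\<close> to the
  gradient, so the Hessian is that of \<open>\<phi>\<close> in the first block and zero
  elsewhere.\<close>

lemma hessian_add_linear_snd:
  fixes \<phi> :: "'a::euclidean_space \<Rightarrow> real" and w :: "'b::euclidean_space"
  assumes \<phi>: "\<And>x. GDERIV \<phi> x :> G x" and G: "G differentiable (at x)"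
  shows "hessian (\<lambda>(x, y). \<phi> x + (w \<bullet> y + d)) (x, y) = (\<lambda>(u, v). (hessian \<phi> x u, 0))"
proof -
  have "GDERIV (\<lambda>(x, y). \<phi> x + (w \<bullet> y + d)) z :> (G (fst z), w)" for z :: "'a \<times> 'b"
  proof -
    \<comment> \<open>Stated within \<open>range fst\<close>, as
      \<open>has_derivative_in_compose\<close> asks for when the inner function is
      \<open>fst\<close>.\<close>
    have "(\<phi> has_derivative (\<lambda>h. h \<bullet> G (fst z))) (at (fst z) within range fst)"
      using \<phi>[of "fst z"] has_derivative_at_withinI unfolding gderiv_def by blast
    then have "((\<lambda>z. \<phi> (fst z)) has_derivative (\<lambda>h. fst h \<bullet> G (fst z))) (at z)"
      by (rule has_derivative_in_compose[rotated]) (auto intro!: derivative_eq_intros)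
    then have "((\<lambda>z. \<phi> (fst z) + (w \<bullet> snd z + d)) has_derivative
        (\<lambda>h. fst h \<bullet> G (fst z) + w \<bullet> snd h)) (at z)"
      by (auto intro!: derivative_eq_intros)
    then show ?thesis
      unfolding gderiv_def case_prod_unfold inner_prod_def by (simp add: inner_commute)
  qed
  then have grad: "gradient (\<lambda>(x, y). \<phi> x + (w \<bullet> y + d)) = (\<lambda>z. (G (fst z), w))"
    using gradient_eqI by blast
  have gradG: "gradient \<phi> = G" using \<phi> gradient_eqI by blast
  have "(G has_derivative hessian \<phi> x) (at x)"
    using G unfolding hessian_def gradG by (simp add: frechet_derivative_works)
  then have "(G has_derivative hessian \<phi> x) (at (fst (x, y)) within range fst)"
    using has_derivative_at_withinI by auto
  then have "((\<lambda>z. G (fst z)) has_derivative (\<lambda>h. hessian \<phi> x (fst h))) (at (x, y))"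
    by (rule has_derivative_in_compose[rotated]) (auto intro!: derivative_eq_intros)
  then have "((\<lambda>z. (G (fst z), w)) has_derivative (\<lambda>(u, v). (hessian \<phi> x u, 0))) (at (x, y))"
    by (auto intro!: derivative_eq_intros simp: case_prod_unfold)
  then show ?thesis
    unfolding hessian_def[of "\<lambda>(x, y). \<phi> x + (w \<bullet> y + d)"] grad
    by (rule frechet_derivative_at[symmetric])
qed

section \<open>Candidates for \<open>y\<close> and coordinatewise sums\<close>

text \<open>Read \<open>N\<close> as n-s, \<open>m\<close> as the number of entries
  \<open>1 + \<epsilon>\<close> of \<open>y\<close>, and \<open>r\<close> as what the others sum to.
  If \<open>m \<ge> N\<close>, the total exceeds \<open>N\<close>; if \<open>m \<le> N - 2\<close>,
  it stays below (N-1)(1+\<open>\<epsilon>\<close>), which is at most N-\<open>\<epsilon>\<close>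
  because N\<open>\<epsilon>\<close> is at most 1.\<close>

lemma card_full_coordinates:
  fixes N m :: nat and \<epsilon> r :: real
  assumes "0 < N" "0 < \<epsilon>" "\<epsilon> \<le> 1 / real N"
    and "0 \<le> r" "r < 1 + \<epsilon>" "real m * (1 + \<epsilon>) + r = real N"
  shows "m = N - 1" "r = 1 - (real N - 1) * \<epsilon>" "0 < r"
proof -
  have N\<epsilon>: "real N * \<epsilon> \<le> 1" using assms by (simp add: field_simps)
  have "m < N"
  proof (rule ccontr)
    assume "\<not> m < N"
    then have "real N * (1 + \<epsilon>) \<le> real m * (1 + \<epsilon>)" using assms by (intro mult_right_mono) auto
    then show False using assms mult_pos_pos[of "real N" \<epsilon>] by (auto simp: algebra_simps simp del: mult_pos_pos)
  qed
  moreover have "\<not> m + 1 < N"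
  proof
    assume "m + 1 < N"
    then have "(real m + 1) * (1 + \<epsilon>) \<le> (real N - 1) * (1 + \<epsilon>)"
      using assms by (intro mult_right_mono) auto
    then show False using assms N\<epsilon> by (simp add: algebra_simps)
  qed
  ultimately show m: "m = N - 1" by simp
  then have m': "real m = real N - 1" using assms by simp
  show r: "r = 1 - (real N - 1) * \<epsilon>" using assms(6) unfolding m' by (simp add: algebra_simps)
  show "0 < r" using N\<epsilon> assms unfolding r by (simp add: algebra_simps)
qed

text \<open>For \<open>j\<close> outside \<open>S\<close> and \<open>S\<close> of size n-s-1, the
  entry at \<open>j\<close> is what remains of n-s after \<open>S\<close> has been filled with
  \<open>1 + \<epsilon>\<close>. The point is then a vertex of the polytope of all \<open>y\<close>
  within the bounds whose entries sum to n-s.\<close>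

definition vertex_point :: "nat \<Rightarrow> real \<Rightarrow> 'n set \<Rightarrow> 'n \<Rightarrow> real ^ 'n" where
  "vertex_point s \<epsilon> S j = (\<chi> i. if i \<in> S then 1 + \<epsilon> else if i = j
     then 1 - (real CARD('n) - real s - 1) * \<epsilon> else 0)"

lemma card_I0: "card (I0 (x :: real ^ 'n)) = CARD('n) - l0_norm x"
proof -
  have "I0 x = UNIV - {i. x $ i \<noteq> 0}" by (auto simp: I0_def)
  then show ?thesis by (simp add: l0_norm_def card_Diff_subset)
qed

lemma sum_scaleR_axis_nth:
  fixes u :: "'n::finite \<Rightarrow> real"
  shows "(\<Sum>i\<in>A. u i *\<^sub>R axis i 1) $ k = (if k \<in> A then u k else 0)"
proof -
  have "(\<Sum>i\<in>A. u i *\<^sub>R axis i 1) $ k = (\<Sum>i\<in>A. if i = k then u i else 0)"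
    unfolding sum_component by (intro sum.cong refl) (simp add: axis_def)
  then show ?thesis by simp
qed

lemma ball_Plus: "(\<forall>i\<in>A <+> B. R i) \<longleftrightarrow> (\<forall>a\<in>A. R (Inl a)) \<and> (\<forall>b\<in>B. R (Inr b))"
  by auto

lemma sum_scaleR_Pair0:
  "(\<Sum>i\<in>A. u i *\<^sub>R (v i, 0 :: 'b::real_vector)) = (\<Sum>i\<in>A. u i *\<^sub>R v i :: 'a::real_vector, 0)"
  "(\<Sum>i\<in>A. u i *\<^sub>R (0 :: 'b, v i)) = (0, \<Sum>i\<in>A. u i *\<^sub>R v i)"
  by (simp_all add: sum_prod)

section \<open>Multipliers and Lagrangian of CCOP\<close>

context
  fixes f :: "real ^ 'n \<Rightarrow> real"
    and P :: "'p set" and h :: "'p \<Rightarrow> real ^ 'n \<Rightarrow> real"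
    and Q :: "'q set" and g :: "'q \<Rightarrow> real ^ 'n \<Rightarrow> real"
    and s :: nat and c :: "real ^ 'n" and \<epsilon> :: real
  assumes finite_P: "finite P" and finite_Q: "finite Q"
begin

lemma finite_Q0: "finite (Q0 Q g x)"
  using finite_Q by (simp add: Q0_def)

text \<open>A coefficient function on the disjoint sum of the index sets is the same as a triple of
  functions, glued together by \<open>case_sum\<close>.\<close>

lemma CC_LICQ_iff:
  "CC_LICQ P h Q g x \<longleftrightarrow> (\<forall>\<alpha> \<beta> \<gamma>.
     (\<Sum>p\<in>P. \<alpha> p *\<^sub>R gradient (h p) x) + (\<Sum>q\<in>Q0 Q g x. \<beta> q *\<^sub>R gradient (g q) x)
       + (\<Sum>i\<in>I0 x. \<gamma> i *\<^sub>R axis i 1) = 0 \<longrightarrow>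
     (\<forall>p\<in>P. \<alpha> p = 0) \<and> (\<forall>q\<in>Q0 Q g x. \<beta> q = 0) \<and> (\<forall>i\<in>I0 x. \<gamma> i = 0))"
  (is "_ \<longleftrightarrow> (\<forall>\<alpha> \<beta> \<gamma>. ?C \<alpha> \<beta> \<gamma>)")
proof -
  have "CC_LICQ P h Q g x \<longleftrightarrow> (\<forall>u. ?C (\<lambda>p. u (Inl p)) (\<lambda>q. u (Inr (Inl q))) (\<lambda>i. u (Inr (Inr i))))"
    unfolding CC_LICQ_def
    by (subst independent_family_iff)
       (simp_all only: finite_P finite_Q0 finite_Plus finite sum.Plus ball_Plus add.assoc comp_def sum.case)
  also have "\<dots> \<longleftrightarrow> (\<forall>\<alpha> \<beta> \<gamma>. ?C \<alpha> \<beta> \<gamma>)"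
  proof (intro iffI allI)
    fix \<alpha> \<beta> \<gamma>
    assume "\<forall>u. ?C (\<lambda>p. u (Inl p)) (\<lambda>q. u (Inr (Inl q))) (\<lambda>i. u (Inr (Inr i)))"
    from spec[OF this, of "case_sum \<alpha> (case_sum \<beta> \<gamma>)"] show "?C \<alpha> \<beta> \<gamma>"
      unfolding sum.case .
  qed (erule allE, erule allE, erule allE)
  finally show ?thesis .
qed

text \<open>Two representations of \<open>gradient f x\<close> differ by a vanishing combination of
  the vectors in CC-LICQ.\<close>

lemma M_multipliers_unique:
  assumes "CC_LICQ P h Q g x" "M_multipliers f P h Q g x lam \<mu> \<gamma>"
    "M_multipliers f P h Q g x lam' \<mu>' \<gamma>'"
  shows "\<forall>p\<in>P. lam p = lam' p" "\<forall>q\<in>Q0 Q g x. \<mu> q = \<mu>' q" "\<forall>i\<in>I0 x. \<gamma> i = \<gamma>' i"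
proof -
  have "(\<Sum>p\<in>P. (lam p - lam' p) *\<^sub>R gradient (h p) x)
      + (\<Sum>q\<in>Q0 Q g x. (\<mu> q - \<mu>' q) *\<^sub>R gradient (g q) x)
      + (\<Sum>i\<in>I0 x. (\<gamma> i - \<gamma>' i) *\<^sub>R axis i 1) = 0"
    using assms(2,3) unfolding M_multipliers_def
    by (simp add: scaleR_diff_left sum_subtractf algebra_simps)
  from assms(1)[unfolded CC_LICQ_iff, rule_format, OF this]
  show "\<forall>p\<in>P. lam p = lam' p" "\<forall>q\<in>Q0 Q g x. \<mu> q = \<mu>' q" "\<forall>i\<in>I0 x. \<gamma> i = \<gamma>' i" by auto
qed

lemma M_Lagrangian_gradient:
  assumes "C2 f" "\<forall>p\<in>P. C2 (h p)" "\<forall>q\<in>Q. C2 (g q)"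
  shows "GDERIV (M_Lagrangian f P h Q g xb lam \<mu> \<gamma>) x :>
      gradient f x - (\<Sum>p\<in>P. lam p *\<^sub>R gradient (h p) x)
        - (\<Sum>q\<in>Q0 Q g xb. \<mu> q *\<^sub>R gradient (g q) x) - (\<Sum>i\<in>I0 xb. \<gamma> i *\<^sub>R axis i 1)"
proof -
  have d: "(\<phi> has_derivative (\<lambda>v. v \<bullet> gradient \<phi> x)) (at x)" if "C2 \<phi>" for \<phi> :: "real ^ 'n \<Rightarrow> real"
    using C2_gderiv[OF that] by (simp add: gderiv_def)
  have "((\<lambda>x. f x - (\<Sum>p\<in>P. lam p * h p x) - (\<Sum>q\<in>Q0 Q g xb. \<mu> q * g q x)
      - (\<Sum>i\<in>I0 xb. \<gamma> i * x $ i)) has_derivative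
    (\<lambda>v. v \<bullet> gradient f x - (\<Sum>p\<in>P. lam p * (v \<bullet> gradient (h p) x))
       - (\<Sum>q\<in>Q0 Q g xb. \<mu> q * (v \<bullet> gradient (g q) x)) - (\<Sum>i\<in>I0 xb. \<gamma> i * v $ i))) (at x)"
    using assms
    by (intro has_derivative_diff has_derivative_sum has_derivative_mult_right d
        bounded_linear_imp_has_derivative bounded_linear_vec_nth) (auto simp: Q0_def)
  then show ?thesis
    unfolding gderiv_def M_Lagrangian_def
    by (simp add: inner_diff_right inner_sum_right inner_axis)
qed

lemma M_Lagrangian_gradient_differentiable:
  assumes "C2 f" "\<forall>p\<in>P. C2 (h p)" "\<forall>q\<in>Q. C2 (g q)"
  shows "(\<lambda>x. gradient f x - (\<Sum>p\<in>P. lam p *\<^sub>R gradient (h p) x)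
        - (\<Sum>q\<in>Q0 Q g xb. \<mu> q *\<^sub>R gradient (g q) x) - (\<Sum>i\<in>I0 xb. \<gamma> i *\<^sub>R axis i 1))
      differentiable (at x)"
proof -
  have d: "(\<lambda>x. k *\<^sub>R gradient \<phi> x) differentiable (at x)"
    if "C2 \<phi>" for k and \<phi> :: "real ^ 'n \<Rightarrow> real"
    using C2_gradient_differentiable[OF that] by (rule differentiable_scaleR[OF differentiable_const])
  show ?thesis
    using assms
    by (intro differentiable_diff differentiable_sum differentiable_const d ballI
        C2_gradient_differentiable) (auto simp: Q0_def finite_P finite_Q)
qed

section \<open>Splitting T-stationarity into its blocks in x and in y\<close>

lemma I0_split:
  assumes "R_feasible P h Q g s \<epsilon> x y"
  shows "I0 x = a01 x y \<union> a00 x y" "a01 x y \<inter> a00 x y = {}"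
proof -
  have "y $ i \<ge> 0" for i using assms by (simp add: R_feasible_def)
  then show "I0 x = a01 x y \<union> a00 x y" "a01 x y \<inter> a00 x y = {}"
    by (auto simp: I0_def a01_def a00_def order.order_iff_strict)
qed

text \<open>The vector equation decouples. Its x-block is the M-stationarity equation, where
  \<open>\<gamma>\<close> is assembled from \<open>\<sigma>1\<close> on \<open>a01\<close> and
  \<open>\<rho>1\<close> on \<open>a00\<close>; its y-block is read coordinate by
  coordinate.\<close>

lemma T_multipliers_iff:
  assumes "R_feasible P h Q g s \<epsilon> x y"
  shows "T_multipliers f P h Q g s c \<epsilon> x y lam \<mu>1 \<mu>2 \<mu>3 \<sigma>1 \<sigma>2 \<rho>1 \<rho>2 \<longleftrightarrow>
    M_multipliers f P h Q g x lam \<mu>1 (\<lambda>i. if y $ i > 0 then \<sigma>1 i else \<rho>1 i) \<and>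
    (\<forall>i. c $ i = \<mu>3 - (if i \<in> E_active \<epsilon> y then \<mu>2 i else 0)
       + (if i \<in> a10 x y then \<sigma>2 i else 0) + (if i \<in> a00 x y then \<rho>2 i else 0)) \<and>
    (\<forall>i\<in>E_active \<epsilon> y. \<mu>2 i \<ge> 0) \<and> \<mu>3 \<ge> 0 \<and> (\<mu>3 = 0 \<or> sum_active s y) \<and>
    (\<forall>i\<in>a00 x y. \<rho>1 i = 0 \<or> \<rho>2 i \<le> 0)"
proof -
  note split = I0_split[OF assms]
  have fin: "finite (A :: 'n set)" for A by simp
  have "(\<Sum>i\<in>I0 x. (if y $ i > 0 then \<sigma>1 i else \<rho>1 i) *\<^sub>R axis i (1::real)) =
      (\<Sum>i\<in>a01 x y. \<sigma>1 i *\<^sub>R axis i 1) + (\<Sum>i\<in>a00 x y. \<rho>1 i *\<^sub>R axis i 1)"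
    unfolding split(1) by (subst sum.union_disjoint[OF fin fin split(2)])
      (auto simp: a01_def a00_def intro!: arg_cong2[where f = "(+)"] sum.cong)
  moreover have "c = - (\<Sum>i\<in>E_active \<epsilon> y. \<mu>2 i *\<^sub>R axis i 1) + \<mu>3 *\<^sub>R (\<chi> i. 1)
      + (\<Sum>i\<in>a10 x y. \<sigma>2 i *\<^sub>R axis i 1) + (\<Sum>i\<in>a00 x y. \<rho>2 i *\<^sub>R axis i 1) \<longleftrightarrow>
    (\<forall>i. c $ i = \<mu>3 - (if i \<in> E_active \<epsilon> y then \<mu>2 i else 0)
      + (if i \<in> a10 x y then \<sigma>2 i else 0) + (if i \<in> a00 x y then \<rho>2 i else 0))"
    unfolding vec_eq_iff vector_add_component vector_uminus_component vector_scaleR_component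
      sum_scaleR_axis_nth by simp
  ultimately show ?thesis
    unfolding T_multipliers_def M_multipliers_def sum.distrib sum_scaleR_Pair0 sum_active_def
    by (auto simp: add.assoc)
qed

text \<open>All constraints in \<open>y\<close> are affine, and x and y occur in separate summands.
  Hence the terms in \<open>y\<close> collect into \<open>w\<close> and \<open>d\<close>, while
  those in x form the CCOP Lagrangian.\<close>

lemma T_Lagrangian_decomp:
  assumes "R_feasible P h Q g s \<epsilon> xb yb"
  shows "\<exists>w d. T_Lagrangian f P h Q g s c \<epsilon> xb yb lam \<mu>1 \<mu>2 \<mu>3 \<sigma>1 \<sigma>2 \<rho>1 \<rho>2 =
    (\<lambda>(x, y). M_Lagrangian f P h Q g xb lam \<mu>1 (\<lambda>i. if yb $ i > 0 then \<sigma>1 i else \<rho>1 i) x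
       + (w \<bullet> y + d))"
proof -
  note split = I0_split[OF assms]
  have fin: "finite (A :: 'n set)" for A by simp
  define w where "w = c + (\<Sum>i\<in>E_active \<epsilon> yb. \<mu>2 i *\<^sub>R axis i 1) - \<mu>3 *\<^sub>R (\<Sum>i\<in>UNIV. axis i 1)
    - (\<Sum>i\<in>a10 xb yb. \<sigma>2 i *\<^sub>R axis i 1) - (\<Sum>i\<in>a00 xb yb. \<rho>2 i *\<^sub>R axis i 1)"
  define d where "d = \<mu>3 * (real CARD('n) - real s) - (\<Sum>i\<in>E_active \<epsilon> yb. \<mu>2 i * (1 + \<epsilon>))"
  have \<gamma>: "(\<Sum>i\<in>I0 xb. (if yb $ i > 0 then \<sigma>1 i else \<rho>1 i) * x $ i) =
      (\<Sum>i\<in>a01 xb yb. \<sigma>1 i * x $ i) + (\<Sum>i\<in>a00 xb yb. \<rho>1 i * x $ i)" for x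
    unfolding split(1) by (subst sum.union_disjoint[OF fin fin split(2)])
      (auto simp: a01_def a00_def intro!: arg_cong2[where f = "(+)"] sum.cong)
  have w: "w \<bullet> y = c \<bullet> y + (\<Sum>i\<in>E_active \<epsilon> yb. \<mu>2 i * y $ i) - \<mu>3 * (\<Sum>i\<in>UNIV. y $ i)
    - (\<Sum>i\<in>a10 xb yb. \<sigma>2 i * y $ i) - (\<Sum>i\<in>a00 xb yb. \<rho>2 i * y $ i)" for y
    unfolding w_def inner_diff_left inner_add_left inner_scaleR_left inner_sum_left
    by (simp add: inner_axis')
  show ?thesis
    by (rule exI[of _ w], rule exI[of _ d])
      (auto simp: fun_eq_iff T_Lagrangian_def M_Lagrangian_def \<gamma> w d_def sum.distrib
        right_diff_distrib sum_subtractf)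
qed

lemma hessian_T_Lagrangian:
  assumes "C2 f" "\<forall>p\<in>P. C2 (h p)" "\<forall>q\<in>Q. C2 (g q)" "R_feasible P h Q g s \<epsilon> x y"
  shows "hessian (T_Lagrangian f P h Q g s c \<epsilon> x y lam \<mu>1 \<mu>2 \<mu>3 \<sigma>1 \<sigma>2 \<rho>1 \<rho>2) (x, y) =
    (\<lambda>(u, v). (hessian (M_Lagrangian f P h Q g x lam \<mu>1
       (\<lambda>i. if y $ i > 0 then \<sigma>1 i else \<rho>1 i)) x u, 0))"
proof -
  obtain w d where "T_Lagrangian f P h Q g s c \<epsilon> x y lam \<mu>1 \<mu>2 \<mu>3 \<sigma>1 \<sigma>2 \<rho>1 \<rho>2 =
    (\<lambda>(x', y'). M_Lagrangian f P h Q g x lam \<mu>1 (\<lambda>i. if y $ i > 0 then \<sigma>1 i else \<rho>1 i) x'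
       + (w \<bullet> y' + d))"
    using T_Lagrangian_decomp[OF assms(4)] by blast
  then show ?thesis
    using hessian_add_linear_snd[OF M_Lagrangian_gradient[OF assms(1-3)]
      M_Lagrangian_gradient_differentiable[OF assms(1-3)]] by simp
qed

section \<open>The form of the T-stationary points\<close>

text \<open>\<open>S\<close> is the set of coordinates at the upper bound and \<open>j\<close> the
  single one strictly between the bounds. Which \<open>j\<close> in \<open>I0 x\<close> can occur is
  left open here.\<close>

lemma T_stationary_imp_vertex_point:
  assumes s: "s < CARD('n)" and c: "\<forall>i. c $ i > 0" "\<forall>i j. i \<noteq> j \<longrightarrow> c $ i \<noteq> c $ j"
    and \<epsilon>: "0 < \<epsilon>" "\<epsilon> \<le> 1 / (real CARD('n) - real s)"
    and T: "T_stationary f P h Q g s c \<epsilon> x y"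
  obtains S j where "j \<in> I0 x" "S \<subseteq> I0 x - {j}" "card S = CARD('n) - s - 1"
    "y = vertex_point s \<epsilon> S j"
proof -
  obtain lam \<mu>1 \<mu>2 \<mu>3 \<sigma>1 \<sigma>2 \<rho>1 \<rho>2 where feas: "R_feasible P h Q g s \<epsilon> x y"
    and "T_multipliers f P h Q g s c \<epsilon> x y lam \<mu>1 \<mu>2 \<mu>3 \<sigma>1 \<sigma>2 \<rho>1 \<rho>2"
    using T unfolding T_stationary_def by blast
  then have ceq: "\<And>i. c $ i = \<mu>3 - (if i \<in> E_active \<epsilon> y then \<mu>2 i else 0)
       + (if i \<in> a10 x y then \<sigma>2 i else 0) + (if i \<in> a00 x y then \<rho>2 i else 0)"
    and \<mu>2: "\<And>i. i \<in> E_active \<epsilon> y \<Longrightarrow> \<mu>2 i \<ge> 0" and \<mu>3: "\<mu>3 = 0 \<or> sum_active s y"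
    unfolding T_multipliers_iff[OF feas] by blast+
  have y: "0 \<le> y $ i" "y $ i \<le> 1 + \<epsilon>" "x $ i * y $ i = 0" for i
    using feas by (auto simp: R_feasible_def)
  have ysum: "(\<Sum>i\<in>UNIV. y $ i) \<ge> real CARD('n) - real s"
    using feas by (simp add: R_feasible_def)
  define E where "E = E_active \<epsilon> y"
  define A where "A = a01 x y"
  have A_iff: "i \<in> A \<longleftrightarrow> y $ i > 0" for i using y(3)[of i] by (auto simp: A_def a01_def)
  have EA: "E \<subseteq> A" using \<epsilon> by (auto simp: E_def E_active_def A_iff)
  \<comment> \<open>Where \<open>y $ i > 0\<close>, feasibility forces \<open>x $ i = 0\<close>, so
    \<open>i\<close> is in neither \<open>a10\<close> nor \<open>a00\<close>, and only
    \<open>\<mu>3\<close> and \<open>\<mu>2\<close> remain in the equation.\<close>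
  have cA: "c $ i = \<mu>3 - (if i \<in> E then \<mu>2 i else 0)" if "i \<in> A" for i
    using ceq[of i] that by (auto simp: E_def A_def a01_def a10_def a00_def)
  have "A \<noteq> {}"
  proof
    assume "A = {}"
    then have "y $ i = 0" for i using A_iff[of i] y(1)[of i] by auto
    then show False using ysum s by simp
  qed
  then obtain i where "i \<in> A" by blast
  \<comment> \<open>As \<open>\<mu>2\<close> is nonnegative on \<open>E\<close>,
    \<open>\<mu>3\<close> is at least \<open>c $ i\<close>.\<close>
  then have "\<mu>3 > 0" using cA[of i] c(1)[rule_format, of i] \<mu>2[of i] by (auto simp: E_def split: if_splits)
  with \<mu>3 have act: "(\<Sum>i\<in>UNIV. y $ i) = real CARD('n) - real s" by (simp add: sum_active_def)
  have AE: "i = j" if "i \<in> A - E" "j \<in> A - E" for i j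
  proof -
    have "c $ i = c $ j" using cA[of i] cA[of j] that by simp
    then show ?thesis using c(2) by blast
  qed
  \<comment> \<open>\<open>A - E\<close> has at most one element, so \<open>r\<close> is the entry
    strictly between the bounds, or 0 if there is none.\<close>
  define r where "r = (\<Sum>i\<in>A - E. y $ i)"
  have "(\<Sum>i\<in>UNIV. y $ i) = (\<Sum>i\<in>A. y $ i)"
    using y(1) A_iff by (intro sum.mono_neutral_right) (auto simp: not_less antisym)
  also have "\<dots> = r + (\<Sum>i\<in>E. y $ i)"
    unfolding r_def using EA by (intro sum.subset_diff) auto
  also have "(\<Sum>i\<in>E. y $ i) = real (card E) * (1 + \<epsilon>)"
    by (simp add: E_def E_active_def)
  finally have eq: "real (card E) * (1 + \<epsilon>) + r = real (CARD('n) - s)"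
    using act s by simp
  have r: "0 \<le> r" "r < 1 + \<epsilon>"
  proof -
    show "0 \<le> r" unfolding r_def using y(1) by (simp add: sum_nonneg)
    show "r < 1 + \<epsilon>"
    proof (cases "A - E = {}")
      case True
      show ?thesis unfolding r_def True using \<epsilon> by simp
    next
      case False
      then obtain i where "A - E = {i}" using AE by blast
      moreover from this have "y $ i \<noteq> 1 + \<epsilon>" by (auto simp: E_def E_active_def)
      ultimately show ?thesis using y(2)[of i] by (simp add: r_def)
    qed
  qed
  have N: "0 < CARD('n) - s" "\<epsilon> \<le> 1 / real (CARD('n) - s)" using s \<epsilon> by (auto simp: of_nat_diff)
  note full = card_full_coordinates[OF N(1) \<epsilon>(1) N(2) r eq]
  \<comment> \<open>The counting yields \<open>0 < r\<close>, which excludes the empty sum.\<close>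
  have "A - E \<noteq> {}" using full(3) unfolding r_def by (metis order_less_irrefl sum.empty)
  then obtain j where j: "A - E = {j}" using AE by blast
  then have yj: "y $ j = 1 - (real CARD('n) - real s - 1) * \<epsilon>"
    using full(2) s by (simp add: r_def of_nat_diff)
  show thesis
  proof (rule that[of j E])
    show "j \<in> I0 x" using j by (auto simp: A_def a01_def I0_def)
    show "E \<subseteq> I0 x - {j}" using EA j by (auto simp: A_def a01_def I0_def)
    show "card E = CARD('n) - s - 1" by (rule full(1))
    have "y $ i = 0" if "i \<notin> E" "i \<noteq> j" for i
    proof -
      have "i \<notin> A" using that j by blast
      then show ?thesis using A_iff[of i] y(1)[of i] by simp
    qed
    then show "y = vertex_point s \<epsilon> E j"
      by (auto simp: vec_eq_iff vertex_point_def yj E_def E_active_def)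
  qed
qed

section \<open>Vertex points above a feasible point: multipliers, tangent space, LICQ, index\<close>

context
  fixes x :: "real ^ 'n" and S :: "'n set" and j :: 'n
  assumes s_less: "s < CARD('n)" and eps: "0 < \<epsilon>" "\<epsilon> \<le> 1 / (real CARD('n) - real s)"
    and feasible: "CCOP_feasible P h Q g s x"
    and j: "j \<in> I0 x" and S: "S \<subseteq> I0 x - {j}" "card S = CARD('n) - s - 1"
begin

abbreviation (input) "yv \<equiv> vertex_point s \<epsilon> S j"

text \<open>With N = n-s, both bounds follow from N\<open>\<epsilon>\<close> being positive and at
  most 1. They place \<open>j\<close> in \<open>a01\<close> but outside
  \<open>E_active\<close>.\<close>

lemma remainder: "0 < 1 - (real CARD('n) - real s - 1) * \<epsilon>" "1 - (real CARD('n) - real s - 1) * \<epsilon> < 1 + \<epsilon>"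
proof -
  have N: "real CARD('n) - real s > 0" using s_less by simp
  then have "(real CARD('n) - real s) * \<epsilon> \<le> 1" using eps by (simp add: field_simps)
  then show "0 < 1 - (real CARD('n) - real s - 1) * \<epsilon>" using eps by (simp add: left_diff_distrib)
  show "1 - (real CARD('n) - real s - 1) * \<epsilon> < 1 + \<epsilon>"
    using mult_pos_pos[OF N eps(1)] by (simp add: left_diff_distrib)
qed

lemma vertex_point_nth:
  "i \<in> S \<Longrightarrow> yv $ i = 1 + \<epsilon>" "yv $ j = 1 - (real CARD('n) - real s - 1) * \<epsilon>"
  "i \<notin> S \<Longrightarrow> i \<noteq> j \<Longrightarrow> yv $ i = 0"
  using S by (auto simp: vertex_point_def)

lemma vertex_point_index_sets:
  "E_active \<epsilon> yv = S" "a01 x yv = insert j S" "a00 x yv = I0 x - insert j S" "a10 x yv = - I0 x"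
  using remainder eps j S
  by (auto simp: E_active_def a01_def a00_def a10_def vertex_point_def I0_def split: if_splits)

text \<open>With N = n-s, the sum is (N-1)(1+\<open>\<epsilon>\<close>) + 1 -
  (N-1)\<open>\<epsilon>\<close> = N.\<close>

lemma vertex_point_sum_active: "sum_active s yv"
proof -
  have "(\<Sum>i\<in>UNIV. yv $ i) = (\<Sum>i\<in>UNIV. (if i \<in> S then 1 + \<epsilon> else 0)
      + (if i = j then 1 - (real CARD('n) - real s - 1) * \<epsilon> else 0))"
    using S by (intro sum.cong) (auto simp: vertex_point_def)
  also have "\<dots> = real (card S) * (1 + \<epsilon>) + (1 - (real CARD('n) - real s - 1) * \<epsilon>)"
    by (simp add: sum.distrib sum.If_cases)
  also have "real (card S) = real CARD('n) - real s - 1"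
    using s_less S(2) by simp
  finally show ?thesis by (simp add: sum_active_def algebra_simps)
qed

lemma vertex_point_feasible: "R_feasible P h Q g s \<epsilon> x yv"
proof -
  have "x $ i * yv $ i = 0 \<and> 0 \<le> yv $ i \<and> yv $ i \<le> 1 + \<epsilon>" for i
    using remainder eps j S by (auto simp: vertex_point_def I0_def)
  then show ?thesis
    using feasible vertex_point_sum_active by (simp add: R_feasible_def CCOP_feasible_def sum_active_def)
qed

text \<open>The equation at coordinate \<open>j\<close> fixes \<open>\<mu>3\<close>, and the
  remaining coordinates then fix \<open>\<mu>2\<close>, \<open>\<sigma>2\<close> and
  \<open>\<rho>2\<close> as differences with \<open>c $ j\<close>. The sign conditions thus become
  comparisons of \<open>c $ i\<close> with \<open>c $ j\<close>.\<close>

lemma T_multipliers_vertex_point: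
  assumes "c $ j > 0"
  shows "T_multipliers f P h Q g s c \<epsilon> x yv lam \<mu>1 \<mu>2 \<mu>3 \<sigma>1 \<sigma>2 \<rho>1 \<rho>2 \<longleftrightarrow>
    M_multipliers f P h Q g x lam \<mu>1 (\<lambda>i. if yv $ i > 0 then \<sigma>1 i else \<rho>1 i) \<and>
    \<mu>3 = c $ j \<and> (\<forall>i\<in>S. \<mu>2 i = c $ j - c $ i \<and> c $ i \<le> c $ j) \<and>
    (\<forall>i. i \<notin> I0 x \<longrightarrow> \<sigma>2 i = c $ i - c $ j) \<and>
    (\<forall>i\<in>I0 x - insert j S. \<rho>2 i = c $ i - c $ j \<and> (\<rho>1 i = 0 \<or> c $ i \<le> c $ j))"
proof -
  have eq: "(\<forall>i. c $ i = \<mu>3 - (if i \<in> S then \<mu>2 i else 0)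
       + (if i \<in> - I0 x then \<sigma>2 i else 0) + (if i \<in> I0 x - insert j S then \<rho>2 i else 0)) \<longleftrightarrow>
    \<mu>3 = c $ j \<and> (\<forall>i\<in>S. \<mu>2 i = c $ j - c $ i) \<and> (\<forall>i. i \<notin> I0 x \<longrightarrow> \<sigma>2 i = c $ i - c $ j) \<and>
    (\<forall>i\<in>I0 x - insert j S. \<rho>2 i = c $ i - c $ j)" (is "(\<forall>i. ?c i) \<longleftrightarrow> ?R")
  proof
    assume a: "\<forall>i. ?c i"
    \<comment> \<open>\<open>j\<close> is outside \<open>S\<close>, \<open>a10\<close> and
      \<open>a00\<close>, so \<open>\<mu>3\<close> is the only multiplier at this
      coordinate.\<close>
    have \<mu>3: "\<mu>3 = c $ j" using a[THEN spec, of j] j S by auto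
    show ?R
    proof (intro conjI ballI allI impI)
      show "\<mu>2 i = c $ j - c $ i" if "i \<in> S" for i using a[THEN spec, of i] that S \<mu>3 by auto
      show "\<sigma>2 i = c $ i - c $ j" if "i \<notin> I0 x" for i using a[THEN spec, of i] that S \<mu>3 by auto
      show "\<rho>2 i = c $ i - c $ j" if "i \<in> I0 x - insert j S" for i
        using a[THEN spec, of i] that S \<mu>3 by auto
    qed (rule \<mu>3)
  next
    assume ?R
    then show "\<forall>i. ?c i" using S by auto
  qed
  have \<mu>2: "(\<forall>i\<in>S. \<mu>2 i = c $ j - c $ i \<and> c $ i \<le> c $ j) \<longleftrightarrow>
      (\<forall>i\<in>S. \<mu>2 i = c $ j - c $ i) \<and> (\<forall>i\<in>S. \<mu>2 i \<ge> 0)"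
    by (metis diff_ge_0_iff_ge)
  have \<rho>2: "(\<forall>i\<in>A. \<rho>2 i = c $ i - c $ j \<and> (\<rho>1 i = 0 \<or> c $ i \<le> c $ j)) \<longleftrightarrow>
      (\<forall>i\<in>A. \<rho>2 i = c $ i - c $ j) \<and> (\<forall>i\<in>A. \<rho>1 i = 0 \<or> \<rho>2 i \<le> 0)" for A
    by (metis diff_le_0_iff_le)
  have "\<mu>3 = c $ j \<Longrightarrow> \<mu>3 \<ge> 0" using assms by simp
  then show ?thesis
    unfolding T_multipliers_iff[OF vertex_point_feasible] vertex_point_index_sets eq \<mu>2 \<rho>2
    using vertex_point_sum_active by blast
qed

text \<open>\<open>\<sigma>1\<close> and \<open>\<rho>1\<close> can both be \<open>\<gamma>\<close>
  because they act on the complementary parts \<open>a01\<close> and \<open>a00\<close> of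
  \<open>I0 x\<close>.\<close>

lemma T_multipliers_vertex_pointI:
  assumes "c $ j > 0" "\<forall>i\<in>I0 x. c $ i \<le> c $ j" "M_multipliers f P h Q g x lam \<mu> \<gamma>"
  shows "T_multipliers f P h Q g s c \<epsilon> x yv lam \<mu> (\<lambda>i. c $ j - c $ i) (c $ j)
    \<gamma> (\<lambda>i. c $ i - c $ j) \<gamma> (\<lambda>i. c $ i - c $ j)"
  unfolding T_multipliers_vertex_point[OF assms(1)] using assms S by auto

text \<open>The active bounds kill every y-coordinate except \<open>j\<close>, and the active sum
  constraint then kills that one too.\<close>

lemma T_tangent_vertex_point: "T_tangent P h Q g s \<epsilon> x yv = (\<lambda>v. (v, 0)) ` M_tangent P h Q g x"
proof -
  have "(a, b) \<in> T_tangent P h Q g s \<epsilon> x yv \<longleftrightarrow> a \<in> M_tangent P h Q g x \<and> b = 0" for a b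
  proof -
    have "(\<forall>i\<in>S. b $ i = 0) \<and> (\<Sum>i\<in>UNIV. b $ i) = 0 \<and> (\<forall>i\<in>(I0 x - insert j S) \<union> - I0 x. b $ i = 0)
        \<longleftrightarrow> b = 0" (is "?L \<longleftrightarrow> _")
    proof
      assume L: ?L
      then have ne: "b $ i = 0" if "i \<noteq> j" for i using that by blast
      then have "(\<Sum>i\<in>UNIV. b $ i) = (\<Sum>i\<in>{j}. b $ i)"
        by (intro sum.mono_neutral_right) auto
      with L ne show "b = 0" by (metis finite.emptyI sum.empty sum.insert empty_iff add_0_right vec_eq_iff zero_index)
    qed simp
    moreover have "(\<chi> i. 1) \<bullet> b = (\<Sum>i\<in>UNIV. b $ i)" by (simp add: inner_vec_def)
    moreover have "I0 x - insert j S \<union> insert j S = I0 x" using j S by auto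
    ultimately show ?thesis
      unfolding T_tangent_def M_tangent_def vertex_point_index_sets
      using vertex_point_sum_active by (auto simp: inner_axis')
  qed
  then show ?thesis by auto
qed

text \<open>The x-block of a vanishing combination is handled by CC-LICQ. In the y-block the unit
  vectors have distinct indices, none equal to \<open>j\<close>, so adding the all-ones vector keeps
  them independent.\<close>

lemma MPOC_LICQ_vertex_point:
  assumes "CC_LICQ P h Q g x"
  shows "MPOC_LICQ P h Q g s \<epsilon> x yv"
proof -
  have I0: "insert j S \<union> (I0 x - insert j S) = I0 x" using j S by auto
  have Pair: "(\<Sum>i\<in>{()}. u i *\<^sub>R (0 :: real ^ 'n, \<chi> i. 1)) = (0, u () *\<^sub>R ((\<chi> i. 1) :: real ^ 'n))" for u
    by simp
  show ?thesis
    unfolding MPOC_LICQ_def vertex_point_index_sets I0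
  proof (subst independent_family_iff, goal_cases)
    case 1
    show ?case by (simp add: finite_P finite_Q0)
  next
    case 2
    show ?case
    proof (intro allI impI, goal_cases)
      case (1 u)
      let ?uP = "\<lambda>p. u (Inl p)" and ?uQ = "\<lambda>q. u (Inr (Inl q))" and ?uE = "\<lambda>i. u (Inr (Inr (Inl i)))"
        and ?ue = "u (Inr (Inr (Inr (Inl ()))))" and ?ux = "\<lambda>i. u (Inr (Inr (Inr (Inr (Inl i)))))"
        and ?uy = "\<lambda>i. u (Inr (Inr (Inr (Inr (Inr i)))))"
      have "(\<Sum>p\<in>P. ?uP p *\<^sub>R gradient (h p) x) + (\<Sum>q\<in>Q0 Q g x. ?uQ q *\<^sub>R gradient (g q) x)
          + (\<Sum>i\<in>I0 x. ?ux i *\<^sub>R axis i 1) = 0 \<and>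
        (\<Sum>i\<in>S. ?uE i *\<^sub>R axis i 1) + ?ue *\<^sub>R (\<chi> i. 1)
          + (\<Sum>i\<in>- I0 x \<union> (I0 x - insert j S). ?uy i *\<^sub>R axis i (1::real)) = 0"
        using 1 vertex_point_sum_active
        by (simp only: if_True sum.Plus finite_P finite_Q0 finite_Plus finite comp_def sum.case
            sum_scaleR_Pair0 Pair) (simp add: zero_prod_def add.assoc)
      then have x: "(\<Sum>p\<in>P. ?uP p *\<^sub>R gradient (h p) x) + (\<Sum>q\<in>Q0 Q g x. ?uQ q *\<^sub>R gradient (g q) x)
          + (\<Sum>i\<in>I0 x. ?ux i *\<^sub>R axis i 1) = 0"
        and "\<And>k. ((\<Sum>i\<in>S. ?uE i *\<^sub>R axis i 1) + ?ue *\<^sub>R (\<chi> i. 1)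
          + (\<Sum>i\<in>- I0 x \<union> (I0 x - insert j S). ?uy i *\<^sub>R axis i (1::real))) $ k = 0"
        by simp_all
      then have y: "(if k \<in> S then ?uE k else 0) + ?ue
          + (if k \<in> - I0 x \<union> (I0 x - insert j S) then ?uy k else 0) = 0" for k
        unfolding vector_add_component vector_scaleR_component sum_scaleR_axis_nth by simp
      have "j \<notin> S" using S by blast
      \<comment> \<open>Coordinate \<open>j\<close> sees only the all-ones vector.\<close>
      then have ue: "?ue = 0" using y[of j] j by simp
      have uE: "?uE k = 0" if "k \<in> S" for k
      proof -
        have "k \<notin> - I0 x \<union> (I0 x - insert j S)" using that S by blast
        then show ?thesis using y[of k] ue that by simp
      qed
      have uy: "?uy k = 0" if "k \<in> - I0 x \<union> (I0 x - insert j S)" for k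
      proof -
        have "k \<notin> S" using that S by blast
        then show ?thesis using y[of k] ue that by simp
      qed
      from assms[unfolded CC_LICQ_iff, THEN spec, THEN spec, THEN spec, THEN mp, OF x]
      show ?case using ue uE uy by (auto split: if_splits)
    qed
  qed
qed

text \<open>The embedding of \<open>v\<close> as \<open>(v, 0)\<close> maps one tangent space onto
  the other and carries one Hessian form to the other.\<close>

lemma restricted_hessian_vertex_point:
  assumes "C2 f" "\<forall>p\<in>P. C2 (h p)" "\<forall>q\<in>Q. C2 (g q)"
  shows "nonsingular_on
      (hessian (T_Lagrangian f P h Q g s c \<epsilon> x yv lam \<mu>1 \<mu>2 \<mu>3 \<sigma>1 \<sigma>2 \<rho>1 \<rho>2) (x, yv))
      (T_tangent P h Q g s \<epsilon> x yv) \<longleftrightarrow>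
    nonsingular_on (hessian (M_Lagrangian f P h Q g x lam \<mu>1
       (\<lambda>i. if yv $ i > 0 then \<sigma>1 i else \<rho>1 i)) x) (M_tangent P h Q g x)" (is ?N)
    "neg_eigenvalues_on
      (hessian (T_Lagrangian f P h Q g s c \<epsilon> x yv lam \<mu>1 \<mu>2 \<mu>3 \<sigma>1 \<sigma>2 \<rho>1 \<rho>2) (x, yv))
      (T_tangent P h Q g s \<epsilon> x yv) =
    neg_eigenvalues_on (hessian (M_Lagrangian f P h Q g x lam \<mu>1
       (\<lambda>i. if yv $ i > 0 then \<sigma>1 i else \<rho>1 i)) x) (M_tangent P h Q g x)" (is ?E)
proof -
  have lin: "linear (\<lambda>v::real ^ 'n. (v, 0 :: real ^ 'n))" by (auto intro!: linearI)
  have inj: "inj (\<lambda>v::real ^ 'n. (v, 0 :: real ^ 'n))" by (auto intro: injI)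
  show ?N ?E
    unfolding T_tangent_vertex_point hessian_T_Lagrangian[OF assms vertex_point_feasible]
    by (rule nonsingular_on_linear_image[OF lin inj] neg_eigenvalues_on_linear_image[OF lin inj];
        simp)+
qed

text \<open>\<open>insert j S\<close> removes n-s of the n-\<open>l0_norm x\<close> elements of
  \<open>I0 x\<close>. This identifies the biactive index BI with the sparsity index SI.\<close>

lemma card_a00_vertex_point: "card (a00 x yv) = s - l0_norm x"
proof -
  have "card (a00 x yv) = card (I0 x) - card (insert j S)"
    unfolding vertex_point_index_sets using j S by (intro card_Diff_subset) auto
  also have "card (insert j S) = CARD('n) - s"
    using S s_less by (subst card_insert_disjoint) auto
  finally show ?thesis using s_less by (simp add: card_I0)
qed

text \<open>Each index is a definite description, so it suffices that both describe the same values
  \<open>m\<close>. Multipliers are transferred in both directions; passing from CCOP to the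
  reformulation uses that \<open>c $ j\<close> is maximal.\<close>

lemma T_index_vertex_point:
  assumes "C2 f" "\<forall>p\<in>P. C2 (h p)" "\<forall>q\<in>Q. C2 (g q)"
    and "c $ j > 0" "\<forall>i\<in>I0 x. c $ i \<le> c $ j"
  shows "T_index f P h Q g s c \<epsilon> x yv = M_index f P h Q g s x"
proof -
  let ?M = "\<lambda>m lam \<mu> \<gamma>. M_multipliers f P h Q g x lam \<mu> \<gamma> \<and>
     m = neg_eigenvalues_on (hessian (M_Lagrangian f P h Q g x lam \<mu> \<gamma>) x) (M_tangent P h Q g x)
         + (s - l0_norm x)"
  let ?T = "\<lambda>m lam \<mu>1 \<mu>2 \<mu>3 \<sigma>1 \<sigma>2 \<rho>1 \<rho>2.
    T_multipliers f P h Q g s c \<epsilon> x yv lam \<mu>1 \<mu>2 \<mu>3 \<sigma>1 \<sigma>2 \<rho>1 \<rho>2 \<and>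
        m = neg_eigenvalues_on
              (hessian (T_Lagrangian f P h Q g s c \<epsilon> x yv lam \<mu>1 \<mu>2 \<mu>3 \<sigma>1 \<sigma>2 \<rho>1 \<rho>2) (x, yv))
              (T_tangent P h Q g s \<epsilon> x yv)
            + card (a00 x yv)"
  have eq: "(\<exists>lam \<mu>1 \<mu>2 \<mu>3 \<sigma>1 \<sigma>2 \<rho>1 \<rho>2. ?T m lam \<mu>1 \<mu>2 \<mu>3 \<sigma>1 \<sigma>2 \<rho>1 \<rho>2) \<longleftrightarrow> (\<exists>lam \<mu> \<gamma>. ?M m lam \<mu> \<gamma>)" for m
  proof
    assume "\<exists>lam \<mu>1 \<mu>2 \<mu>3 \<sigma>1 \<sigma>2 \<rho>1 \<rho>2. ?T m lam \<mu>1 \<mu>2 \<mu>3 \<sigma>1 \<sigma>2 \<rho>1 \<rho>2"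
    then obtain lam \<mu>1 \<mu>2 \<mu>3 \<sigma>1 \<sigma>2 \<rho>1 \<rho>2 where "?T m lam \<mu>1 \<mu>2 \<mu>3 \<sigma>1 \<sigma>2 \<rho>1 \<rho>2" by (elim exE)
    then have "?M m lam \<mu>1 (\<lambda>i. if yv $ i > 0 then \<sigma>1 i else \<rho>1 i)"
      using T_multipliers_vertex_point[OF assms(4)] restricted_hessian_vertex_point(2)[OF assms(1-3)]
        card_a00_vertex_point by auto
    then show "\<exists>lam \<mu> \<gamma>. ?M m lam \<mu> \<gamma>" by (intro exI)
  next
    assume "\<exists>lam \<mu> \<gamma>. ?M m lam \<mu> \<gamma>"
    then obtain lam \<mu> \<gamma> where "?M m lam \<mu> \<gamma>" by (elim exE)
    then have "?T m lam \<mu> (\<lambda>i. c $ j - c $ i) (c $ j) \<gamma> (\<lambda>i. c $ i - c $ j) \<gamma> (\<lambda>i. c $ i - c $ j)"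
      using T_multipliers_vertex_pointI[OF assms(4,5)] card_a00_vertex_point
      unfolding restricted_hessian_vertex_point(2)[OF assms(1-3)] by simp
    then show "\<exists>lam \<mu>1 \<mu>2 \<mu>3 \<sigma>1 \<sigma>2 \<rho>1 \<rho>2. ?T m lam \<mu>1 \<mu>2 \<mu>3 \<sigma>1 \<sigma>2 \<rho>1 \<rho>2" by (intro exI)
  qed
  show ?thesis unfolding T_index_def M_index_def eq ..
qed

text \<open>The strict inequalities for \<open>\<mu>2\<close> and \<open>\<rho>2\<close> come from
  \<open>c $ j\<close> being the strict maximum. NDM3 makes \<open>\<gamma>\<close> nonzero on
  \<open>I0 x\<close> when \<open>a00\<close> is nonempty, which gives both the condition on
  \<open>\<rho>1\<close> and NDT5.\<close>

lemma T_nondegenerate_vertex_point: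
  assumes "C2 f" "\<forall>p\<in>P. C2 (h p)" "\<forall>q\<in>Q. C2 (g q)"
    and "c $ j > 0" "\<forall>i\<in>I0 x - {j}. c $ i < c $ j"
    and "M_nondegenerate f P h Q g s x"
  shows "T_nondegenerate f P h Q g s c \<epsilon> x yv" "NDT5 f P h Q g s c \<epsilon> x yv"
proof -
  obtain lam \<mu> \<gamma> where M: "M_multipliers f P h Q g x lam \<mu> \<gamma>" and LICQ: "CC_LICQ P h Q g x"
    and \<mu>: "\<forall>q\<in>Q0 Q g x. \<mu> q > 0" and \<gamma>: "l0_norm x < s \<longrightarrow> (\<forall>i\<in>I0 x. \<gamma> i \<noteq> 0)"
    and ns: "nonsingular_on (hessian (M_Lagrangian f P h Q g x lam \<mu> \<gamma>) x) (M_tangent P h Q g x)"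
    using assms(6) unfolding M_nondegenerate_def by blast
  have "\<forall>i\<in>I0 x. c $ i \<le> c $ j" using assms(5) by (metis DiffI order_less_imp_le order_refl singletonD)
  note T = T_multipliers_vertex_pointI[OF assms(4) this M]
  \<comment> \<open>\<open>a00\<close> has \<open>s - l0_norm x\<close> elements, so its
    nonemptiness is the premise of NDM3.\<close>
  have \<gamma>0: "\<forall>i\<in>I0 x. \<gamma> i \<noteq> 0" if "a00 x yv \<noteq> {}"
    using \<gamma> that card_a00_vertex_point card_gt_0_iff[of "a00 x yv"] by simp
  show "NDT5 f P h Q g s c \<epsilon> x yv"
    unfolding NDT5_def
    by (intro exI conjI impI, rule T) (use \<gamma>0 in \<open>auto simp: a01_def I0_def\<close>)
  show "T_nondegenerate f P h Q g s c \<epsilon> x yv"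
    unfolding T_nondegenerate_def
  proof (intro conjI exI)
    show "nonsingular_on (hessian (T_Lagrangian f P h Q g s c \<epsilon> x yv lam \<mu> (\<lambda>i. c $ j - c $ i) (c $ j)
        \<gamma> (\<lambda>i. c $ i - c $ j) \<gamma> (\<lambda>i. c $ i - c $ j)) (x, yv)) (T_tangent P h Q g s \<epsilon> x yv)"
      unfolding restricted_hessian_vertex_point(1)[OF assms(1-3)] using ns by simp
    show "\<forall>i\<in>a00 x yv. \<gamma> i \<noteq> 0 \<and> c $ i - c $ j < 0"
      using \<gamma>0 assms(5) unfolding vertex_point_index_sets by auto
    show "\<forall>i\<in>E_active \<epsilon> yv. 0 < c $ j - c $ i"
      using assms(5) S unfolding vertex_point_index_sets by auto
  qed (use vertex_point_feasible T MPOC_LICQ_vertex_point[OF LICQ] \<mu> assms(4) in auto)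
qed

end

text \<open>For a degenerate M-stationary point the index $j$ of the component strictly between
  $0$ and $1+\varepsilon$ need not maximize $c$ over $I_0(x)$: multipliers $\varrho_{1,i} = 0$
  leave the sign of $\varrho_{2,i} = c_i - c_j$ free.\<close>

lemma T_stationary_nondegenerate_max:
  assumes s: "s < CARD('n)" and c: "\<forall>i. c $ i > 0"
    and \<epsilon>: "0 < \<epsilon>" "\<epsilon> \<le> 1 / (real CARD('n) - real s)"
    and j: "j \<in> I0 x" and S: "S \<subseteq> I0 x - {j}" "card S = CARD('n) - s - 1"
    and nd: "M_nondegenerate f P h Q g s x"
    and T: "T_stationary f P h Q g s c \<epsilon> x (vertex_point s \<epsilon> S j)"
  shows "\<forall>i\<in>I0 x. c $ i \<le> c $ j"
proof
  fix i assume i: "i \<in> I0 x"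
  from nd have feas: "CCOP_feasible P h Q g s x" by (simp add: M_nondegenerate_def)
  note ctx = s \<epsilon> feas j S
  let ?y = "vertex_point s \<epsilon> S j"
  obtain lam \<mu> \<gamma> where M: "M_multipliers f P h Q g x lam \<mu> \<gamma>" and LICQ: "CC_LICQ P h Q g x"
    and \<gamma>: "l0_norm x < s \<longrightarrow> (\<forall>i\<in>I0 x. \<gamma> i \<noteq> 0)"
    using nd unfolding M_nondegenerate_def by blast
  obtain lam' \<mu>1 \<mu>2 \<mu>3 \<sigma>1 \<sigma>2 \<rho>1 \<rho>2 where
    "T_multipliers f P h Q g s c \<epsilon> x ?y lam' \<mu>1 \<mu>2 \<mu>3 \<sigma>1 \<sigma>2 \<rho>1 \<rho>2"
    using T unfolding T_stationary_def by blast
  note T' = this[unfolded T_multipliers_vertex_point[OF ctx c[rule_format]]]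
  \<comment> \<open>Uniqueness under CC-LICQ lets the conditions on \<open>\<gamma>\<close> speak
    about the given \<open>\<sigma>1\<close> and \<open>\<rho>1\<close>.\<close>
  have \<gamma>': "\<gamma> k = (if ?y $ k > 0 then \<sigma>1 k else \<rho>1 k)" if "k \<in> I0 x" for k
    using M_multipliers_unique(3)[OF LICQ M conjunct1[OF T']] that by blast
  \<comment> \<open>The sign of \<open>\<mu>2\<close> settles \<open>i\<close> in \<open>S\<close>.
    In the third case the sign of \<open>\<rho>2\<close> is available once \<open>\<rho>1 i\<close>
    is nonzero, which NDM3 supplies.\<close>
  consider "i = j" | "i \<in> S" | "i \<in> I0 x - insert j S" using i by blast
  then show "c $ i \<le> c $ j"
  proof cases
    case 3
    then have "a00 x ?y \<noteq> {}" unfolding vertex_point_index_sets[OF ctx] by blast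
    then have "l0_norm x < s"
      using card_a00_vertex_point[OF ctx] card_gt_0_iff[of "a00 x ?y"] by simp
    with \<gamma> i have "\<gamma> i \<noteq> 0" by blast
    moreover have "?y $ i = 0" using 3 by (simp add: vertex_point_nth[OF ctx])
    ultimately have "\<rho>1 i \<noteq> 0" using \<gamma>'[OF i] by simp
    then show ?thesis using T' 3 by blast
  qed (use T' in auto)
qed

end

section \<open>Counting the T-stationary points above an M-stationary point\<close>

theorem theorem2:
  fixes f :: "real ^ 'n \<Rightarrow> real"
    and P :: "'p set" and h :: "'p \<Rightarrow> real ^ 'n \<Rightarrow> real"
    and Q :: "'q set" and g :: "'q \<Rightarrow> real ^ 'n \<Rightarrow> real"
    and s :: nat and c :: "real ^ 'n" and \<epsilon> :: real and xb :: "real ^ 'n"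
  assumes "s < CARD('n)"
    and "finite P" and "finite Q"
    and "C2 f" and "\<forall>p\<in>P. C2 (h p)" and "\<forall>q\<in>Q. C2 (g q)"
    and "\<forall>i. c $ i > 0" and "\<forall>i j. i \<noteq> j \<longrightarrow> c $ i \<noteq> c $ j"
    and "0 < \<epsilon>" and "\<epsilon> \<le> 1 / (real CARD('n) - real s)"
    and "M_stationary f P h Q g s xb"
  shows "(\<exists>Y. finite Y \<and>
            card Y = (CARD('n) - l0_norm xb - 1) choose (CARD('n) - s - 1) \<and>
            (\<forall>y\<in>Y. T_stationary f P h Q g s c \<epsilon> xb y)) \<and>
         (\<forall>m. M_nondegenerate f P h Q g s xb \<and> M_index f P h Q g s xb = m \<longrightarrow>
            (\<forall>y. T_stationary f P h Q g s c \<epsilon> xb y \<longrightarrow>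
               T_nondegenerate f P h Q g s c \<epsilon> xb y \<and>
               T_index f P h Q g s c \<epsilon> xb y = m \<and>
               NDT5 f P h Q g s c \<epsilon> xb y) \<and>
            finite {y. T_stationary f P h Q g s c \<epsilon> xb y} \<and>
            card {y. T_stationary f P h Q g s c \<epsilon> xb y} =
              (CARD('n) - l0_norm xb - 1) choose (CARD('n) - s - 1))"
proof -
  note fin = assms(2,3) and s = assms(1) and C2 = assms(4-6) and c = assms(7,8) and \<epsilon> = assms(9,10)
  obtain lam \<mu> \<gamma> where feas: "CCOP_feasible P h Q g s xb" and M: "M_multipliers f P h Q g xb lam \<mu> \<gamma>"
    using assms(11) unfolding M_stationary_def by blast
  \<comment> \<open>At least n-s components of \<open>xb\<close> vanish, so \<open>c\<close> attains
    a maximum over them.\<close>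
  have "card (I0 xb) > 0" using feas s by (simp add: card_I0 CCOP_feasible_def)
  then have "I0 xb \<noteq> {}" by auto
  then have "Max (($) c ` I0 xb) \<in> ($) c ` I0 xb" by (intro Max_in) auto
  then obtain j where j: "j \<in> I0 xb" "Max (($) c ` I0 xb) = c $ j" by auto
  then have jmax: "\<forall>i\<in>I0 xb. c $ i \<le> c $ j" by (metis Max_ge finite finite_imageI imageI)
  then have jmax': "\<forall>i\<in>I0 xb - {j}. c $ i < c $ j" using c(2) by (metis DiffE insertI1 order_less_le)
  define V where "V = {S. S \<subseteq> I0 xb - {j} \<and> card S = CARD('n) - s - 1}"
  define Y where "Y = (\<lambda>S. vertex_point s \<epsilon> S j) ` V"
  have ctx: "s < CARD('n)" "0 < \<epsilon>" "\<epsilon> \<le> 1 / (real CARD('n) - real s)" "CCOP_feasible P h Q g s xb"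
      "j \<in> I0 xb" "S \<subseteq> I0 xb - {j}" "card S = CARD('n) - s - 1" if "S \<in> V" for S
    using s \<epsilon> feas j that by (auto simp: V_def)
  \<comment> \<open>\<open>S\<close> is recovered from the point as its set of coordinates at the
    upper bound.\<close>
  have "inj_on (\<lambda>S. vertex_point s \<epsilon> S j) V"
    by (rule inj_on_inverseI[where g = "E_active \<epsilon>"]) (rule vertex_point_index_sets(1)[OF fin ctx])
  then have "card Y = card V" unfolding Y_def by (rule card_image)
  also have "\<dots> = card (I0 xb - {j}) choose (CARD('n) - s - 1)"
    unfolding V_def by (rule n_subsets) simp
  also have "card (I0 xb - {j}) = CARD('n) - l0_norm xb - 1"
    using j by (simp add: card_I0)
  finally have cardY: "card Y = (CARD('n) - l0_norm xb - 1) choose (CARD('n) - s - 1)" .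
  have finY: "finite Y" by (simp add: Y_def V_def)
  have TY: "T_stationary f P h Q g s c \<epsilon> xb y" if "y \<in> Y" for y
  proof -
    obtain S where S: "S \<in> V" "y = vertex_point s \<epsilon> S j" using \<open>y \<in> Y\<close> unfolding Y_def by blast
    show ?thesis
      unfolding T_stationary_def S(2)
      using vertex_point_feasible[OF fin ctx[OF S(1)]]
        T_multipliers_vertex_pointI[OF fin ctx[OF S(1)] c(1)[rule_format] jmax M] by blast
  qed
  \<comment> \<open>Under nondegeneracy \<open>Y\<close> exhausts the T-stationary points: each is a
    vertex point for some \<open>k\<close>, and this \<open>k\<close> must maximize \<open>c\<close>
    over \<open>I0 xb\<close>.\<close>
  have YT: "y \<in> Y" if nd: "M_nondegenerate f P h Q g s xb" and T: "T_stationary f P h Q g s c \<epsilon> xb y" for y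
  proof -
    obtain S k where k: "k \<in> I0 xb" "S \<subseteq> I0 xb - {k}" "card S = CARD('n) - s - 1"
      "y = vertex_point s \<epsilon> S k"
      using T_stationary_imp_vertex_point[OF fin s c \<epsilon> T] .
    have "\<forall>i\<in>I0 xb. c $ i \<le> c $ k"
      using T_stationary_nondegenerate_max[OF fin s c(1) \<epsilon> k(1-3) nd T[unfolded k(4)]] .
    \<comment> \<open>The maximizer is unique because the components of \<open>c\<close> are
      pairwise different.\<close>
    then have "k = j" using jmax' k(1) j(1) by (metis DiffI leD singletonD)
    with k show ?thesis by (auto simp: Y_def V_def)
  qed
  show ?thesis
  proof (intro conjI allI impI)
    show "\<exists>Y. finite Y \<and> card Y = (CARD('n) - l0_norm xb - 1) choose (CARD('n) - s - 1) \<and>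
            (\<forall>y\<in>Y. T_stationary f P h Q g s c \<epsilon> xb y)"
      using finY cardY TY by blast
    fix m assume m: "M_nondegenerate f P h Q g s xb \<and> M_index f P h Q g s xb = m"
    then have nd: "M_nondegenerate f P h Q g s xb" by blast
    have eq: "{y. T_stationary f P h Q g s c \<epsilon> xb y} = Y" using TY YT[OF nd] by blast
    show "finite {y. T_stationary f P h Q g s c \<epsilon> xb y}"
      "card {y. T_stationary f P h Q g s c \<epsilon> xb y} = (CARD('n) - l0_norm xb - 1) choose (CARD('n) - s - 1)"
      unfolding eq by (fact finY cardY)+
    fix y assume "T_stationary f P h Q g s c \<epsilon> xb y"
    then obtain S where S: "S \<in> V" "y = vertex_point s \<epsilon> S j" using eq unfolding Y_def by blast
    note ctx = fin ctx[OF S(1)]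
    show "T_nondegenerate f P h Q g s c \<epsilon> xb y" "NDT5 f P h Q g s c \<epsilon> xb y"
      unfolding S(2) using T_nondegenerate_vertex_point[OF ctx C2 c(1)[rule_format] jmax' nd] by blast+
    show "T_index f P h Q g s c \<epsilon> xb y = m"
      unfolding S(2) using T_index_vertex_point[OF ctx C2 c(1)[rule_format] jmax] m by simp
  qed
qed

end
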